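(* Let $0<\theta \leq 1/4$. Let $A$ be a fixed positive real number, with $A \leq 1/2$ if $\theta=1/4$. There are infinitely many primes $p$ such that for some integer $d \in \left[\frac{p^{1-\theta}}{2A}+1, \frac{2p^{1-\theta}}{A}+1\right]$, there is a smooth nontrivially blocking plane curve over $\mathbb{F}_p$ with degree $d$.
   Context: A plane curve $C=\{F=0\}\subset\mathbb{P}^2$ of degree $d$ over $\mathbb{F}_q$ is given by a nonzero homogeneous polynomial $F\in\mathbb{F}_q[x,y,z]$ of degree $d$. It is smooth if at every point $P\in C$ (over $\overline{\mathbb{F}_q}$) at least one of the partial derivatives $F_x,F_y,F_z$ does not vanish. $C(\mathbb{F}_q)$ is the set of points $[x:y:z]\in\mathbb{P}^2(\mathbb{F}_q)$ with $F(x,y,z)=0$. A set $B\subseteq\mathbb{P}^2(\mathbb{F}_q)$ is a blocking set if every line of $\mathbb{P}^2$ defined over $\mathbb{F}_q$ (an $\mathbb{F}_q$-line) contains a point of $B$; it is a nontrivial blocking set if moreover it does not contain all the $\mathbb{F}_q$-points of any $\mathbb{F}_q$-line. The curve $C$ is nontrivially blocking over $\mathbb{F}_q$ if $C(\mathbb{F}_q)$ is a nontrivial blocking set. *)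

theory Defs
  imports
    Complex_Main
    "HOL-Algebra.Algebraic_Closure"
    "HOL-Number_Theory.Residues"
begin

section \<open>Ternary forms\<close>

text \<open>
  Ternary polynomials over a ring R are the indexed polynomials of HOL-Algebra in three
  variables: a monomial is a multiset of variables, and a polynomial maps every monomial to its
  coefficient. Membership in \<^const>\<open>ring.indexed_pset\<close> forces the support to be finite.
\<close>

datatype coord = CX | CY | CZ

type_synonym 'a tpoly = "coord multiset \<Rightarrow> 'a"

definition ternary_polys :: "('a, 'b) ring_scheme \<Rightarrow> 'a tpoly set" where
  "ternary_polys R = ring.indexed_pset R UNIV (carrier R)"

definition homogeneous :: "('a, 'b) ring_scheme \<Rightarrow> nat \<Rightarrow> 'a tpoly \<Rightarrow> bool" where
  "homogeneous R d F \<longleftrightarrow> (\<forall>m. F m \<noteq> \<zero>\<^bsub>R\<^esub> \<longrightarrow> size m = d)"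

definition tpoly_eval :: "('a, 'b) ring_scheme \<Rightarrow> 'a tpoly \<Rightarrow> 'a \<times> 'a \<times> 'a \<Rightarrow> 'a" where
  "tpoly_eval R F = (\<lambda>(x, y, z). \<Oplus>\<^bsub>R\<^esub>m \<in> {m. F m \<noteq> \<zero>\<^bsub>R\<^esub>}.
     F m \<otimes>\<^bsub>R\<^esub> (x [^]\<^bsub>R\<^esub> count m CX \<otimes>\<^bsub>R\<^esub> y [^]\<^bsub>R\<^esub> count m CY \<otimes>\<^bsub>R\<^esub> z [^]\<^bsub>R\<^esub> count m CZ))"

text \<open>
  Formal partial derivative: the coefficient of m in the derivative by the variable i is
  e times the coefficient of the product of m and i, where e is the exponent of i in that product.
\<close>

definition tpoly_deriv :: "('a, 'b) ring_scheme \<Rightarrow> coord \<Rightarrow> 'a tpoly \<Rightarrow> 'a tpoly" where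
  "tpoly_deriv R i F = (\<lambda>m. [Suc (count m i)] \<cdot>\<^bsub>R\<^esub> F (add_mset i m))"


section \<open>The projective plane\<close>

definition nonzero_triples :: "('a, 'b) ring_scheme \<Rightarrow> ('a \<times> 'a \<times> 'a) set" where
  "nonzero_triples R = (carrier R \<times> carrier R \<times> carrier R) - {(\<zero>\<^bsub>R\<^esub>, \<zero>\<^bsub>R\<^esub>, \<zero>\<^bsub>R\<^esub>)}"

text \<open>A projective point is the set of all its homogeneous coordinate vectors.\<close>

definition proj_point :: "('a, 'b) ring_scheme \<Rightarrow> 'a \<times> 'a \<times> 'a \<Rightarrow> ('a \<times> 'a \<times> 'a) set" where
  "proj_point R = (\<lambda>(x, y, z). {(c \<otimes>\<^bsub>R\<^esub> x, c \<otimes>\<^bsub>R\<^esub> y, c \<otimes>\<^bsub>R\<^esub> z) | c. c \<in> carrier R - {\<zero>\<^bsub>R\<^esub>}})"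

definition proj_plane :: "('a, 'b) ring_scheme \<Rightarrow> ('a \<times> 'a \<times> 'a) set set" where
  "proj_plane R = proj_point R ` nonzero_triples R"

definition proj_line :: "('a, 'b) ring_scheme \<Rightarrow> 'a \<times> 'a \<times> 'a \<Rightarrow> ('a \<times> 'a \<times> 'a) set set" where
  "proj_line R = (\<lambda>(a, b, c). {proj_point R (x, y, z) | x y z.
     (x, y, z) \<in> nonzero_triples R \<and>
     a \<otimes>\<^bsub>R\<^esub> x \<oplus>\<^bsub>R\<^esub> b \<otimes>\<^bsub>R\<^esub> y \<oplus>\<^bsub>R\<^esub> c \<otimes>\<^bsub>R\<^esub> z = \<zero>\<^bsub>R\<^esub>})"

definition proj_lines :: "('a, 'b) ring_scheme \<Rightarrow> ('a \<times> 'a \<times> 'a) set set set" where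
  "proj_lines R = proj_line R ` nonzero_triples R"


section \<open>Blocking sets\<close>

definition blocking_set :: "('a, 'b) ring_scheme \<Rightarrow> ('a \<times> 'a \<times> 'a) set set \<Rightarrow> bool" where
  "blocking_set R B \<longleftrightarrow> B \<subseteq> proj_plane R \<and> (\<forall>L \<in> proj_lines R. L \<inter> B \<noteq> {})"

definition nontrivial_blocking_set ::
  "('a, 'b) ring_scheme \<Rightarrow> ('a \<times> 'a \<times> 'a) set set \<Rightarrow> bool" where
  "nontrivial_blocking_set R B \<longleftrightarrow> blocking_set R B \<and> (\<forall>L \<in> proj_lines R. \<not> L \<subseteq> B)"


section \<open>Plane curves\<close>

definition plane_curve :: "('a, 'b) ring_scheme \<Rightarrow> nat \<Rightarrow> 'a tpoly \<Rightarrow> bool" where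
  "plane_curve R d F \<longleftrightarrow>
     F \<in> ternary_polys R \<and> F \<noteq> (\<lambda>_. \<zero>\<^bsub>R\<^esub>) \<and> homogeneous R d F"

text \<open>
  For homogeneous F, vanishing does not depend on the coordinate vector chosen for the point, so
  the quantifier over all of them could equally well be existential.
\<close>

definition vanishes_at ::
  "('a, 'b) ring_scheme \<Rightarrow> 'a tpoly \<Rightarrow> ('a \<times> 'a \<times> 'a) set \<Rightarrow> bool" where
  "vanishes_at R F P \<longleftrightarrow> (\<forall>v \<in> P. tpoly_eval R F v = \<zero>\<^bsub>R\<^esub>)"

definition curve_points :: "('a, 'b) ring_scheme \<Rightarrow> 'a tpoly \<Rightarrow> ('a \<times> 'a \<times> 'a) set set" where
  "curve_points R F = {P \<in> proj_plane R. vanishes_at R F P}"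

text \<open>
  Smoothness is tested at the points over the algebraic closure. The field R itself is not a
  subset of \<^const>\<open>field.alg_closure\<close>; its embedding is \<^const>\<open>ring.indexed_const\<close>, which is
  applied to the coefficients of F here.
\<close>

definition smooth_curve :: "('a, 'b) ring_scheme \<Rightarrow> 'a tpoly \<Rightarrow> bool" where
  "smooth_curve R F \<longleftrightarrow>
     (let L = field.alg_closure R; G = ring.indexed_const R \<circ> F in
      \<forall>P \<in> curve_points L G. \<exists>i. \<not> vanishes_at L (tpoly_deriv L i G) P)"

definition nontrivially_blocking :: "('a, 'b) ring_scheme \<Rightarrow> 'a tpoly \<Rightarrow> bool" where
  "nontrivially_blocking R F \<longleftrightarrow> nontrivial_blocking_set R (curve_points R F)"

end

theory Submission
  imports
    Defs
    "HOL-Computational_Algebra.Polynomial"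
    "HOL-Number_Theory.Residue_Primitive_Roots"
    "HOL-Real_Asymp.Real_Asymp"
begin

text \<open>
  The curve is y f(x, z) = l z g(y, z) with f and g monic of degree n = d - 1. It passes smoothly
  through [1:0:0] and [0:1:0], which block all lines through them, and it contains every point
  (x, y) with f(x) = g(y) = 0. The line y = 0 meets it only in [1:0:0], so any line all of
  whose F_p-points lie on it passes through [1:0:0], and those lines are y = const and z = 0.
  For the roots of f one takes the set Z of the r m elements of F_p whose r-th power lies in a set
  T of m nonzero r-th powers, that is, f is the e-th power of h(x^r), where h has root set T and
  n = r m e; for the roots of g, a set Y of n nonzero elements meeting a Z + b for all a, b with a
  nonzero, which exists by greedy choice once n (r m - 1) > 2 (p - 1) ln p. An affine singular
  point would give f(x) = l g'(y), where f(x) is a nonzero critical value of f and y g'(y) = g(y).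
  There are at most m such critical values and at most n such y, so some l in F_p works once
  m n < p - 1. The two inequalities are compatible if r exceeds 2 log_2 p, and prime divisors p of
  Fermat numbers have such divisors r of p - 1 of size O(log p).
\<close>

section \<open>Ternary forms with integer coefficients\<close>

definition monomial_mset :: "nat \<Rightarrow> nat \<Rightarrow> nat \<Rightarrow> coord multiset" where
  "monomial_mset i j k = replicate_mset i CX + replicate_mset j CY + replicate_mset k CZ"

lemma count_monomial_mset [simp]:
  "count (monomial_mset i j k) CX = i"
  "count (monomial_mset i j k) CY = j"
  "count (monomial_mset i j k) CZ = k"
  by (simp_all add: monomial_mset_def)

lemma size_monomial_mset [simp]: "size (monomial_mset i j k) = i + j + k"
  by (simp add: monomial_mset_def)

lemma add_mset_eq_monomial_mset:
  "add_mset CX m = monomial_mset i j k \<longleftrightarrow> i > 0 \<and> m = monomial_mset (i - 1) j k"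
  "add_mset CY m = monomial_mset i j k \<longleftrightarrow> j > 0 \<and> m = monomial_mset i (j - 1) k"
  "add_mset CZ m = monomial_mset i j k \<longleftrightarrow> k > 0 \<and> m = monomial_mset i j (k - 1)"
proof -
  have *: "add_mset c m = monomial_mset i j k \<longleftrightarrow>
      count (monomial_mset i j k) c > 0 \<and> m = monomial_mset i j k - {#c#}" for c
    by (metis add_mset_remove_trivial count_greater_zero_iff insert_DiffM union_single_eq_member)
  show "add_mset CX m = monomial_mset i j k \<longleftrightarrow> i > 0 \<and> m = monomial_mset (i - 1) j k"
    unfolding * by (cases i) (auto simp: monomial_mset_def)
  show "add_mset CY m = monomial_mset i j k \<longleftrightarrow> j > 0 \<and> m = monomial_mset i (j - 1) k"
    unfolding * by (cases j) (auto simp: monomial_mset_def)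
  show "add_mset CZ m = monomial_mset i j k \<longleftrightarrow> k > 0 \<and> m = monomial_mset i j (k - 1)"
    unfolding * by (cases k) (auto simp: monomial_mset_def)
qed

text \<open>A list entry (a, i, j, k) stands for the term a x^i y^j z^k.\<close>

type_synonym int_form = "(int \<times> nat \<times> nat \<times> nat) list"

fun form_coeff :: "int_form \<Rightarrow> coord multiset \<Rightarrow> int" where
  "form_coeff [] m = 0"
| "form_coeff ((a, i, j, k) # Q) m =
     (if m = monomial_mset i j k then a else 0) + form_coeff Q m"

text \<open>An entry free of the variable gets coefficient 0, so the truncated \<open>i - 1\<close>
  does no harm.\<close>

fun term_deriv :: "coord \<Rightarrow> int \<times> nat \<times> nat \<times> nat \<Rightarrow> int \<times> nat \<times> nat \<times> nat" where
  "term_deriv CX (a, i, j, k) = (int i * a, i - 1, j, k)"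
| "term_deriv CY (a, i, j, k) = (int j * a, i, j - 1, k)"
| "term_deriv CZ (a, i, j, k) = (int k * a, i, j, k - 1)"

lemma form_coeff_deriv:
  "form_coeff (map (term_deriv c) Q) m = int (Suc (count m c)) * form_coeff Q (add_mset c m)"
  by (induction Q "add_mset c m" rule: form_coeff.induct; cases c)
     (auto simp: add_mset_eq_monomial_mset algebra_simps)

lemma finite_form_coeff_support: "finite {m. form_coeff Q m \<noteq> 0}"
proof (induction Q)
  case (Cons q Q)
  obtain a i j k where q: "q = (a, i, j, k)"
    by (cases q) auto
  have "{m. form_coeff (q # Q) m \<noteq> 0} \<subseteq> insert (monomial_mset i j k) {m. form_coeff Q m \<noteq> 0}"
    by (auto simp: q)
  then show ?case
    using Cons finite_subset by blast
qed auto

lemma form_coeff_homogeneous: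
  assumes "\<forall>(a, i, j, k) \<in> set Q. i + j + k = d" "form_coeff Q m \<noteq> 0"
  shows "size m = d"
  using assms by (induction Q m rule: form_coeff.induct) (auto split: if_splits)

section \<open>Evaluating integer forms in a field\<close>

text \<open>\<open>\<phi>\<close> is a ring homomorphism from the integers whose kernel is generated
  by \<open>p\<close>. With the integers as source, the same \<open>f\<close>, \<open>g\<close> and
  \<open>curve_form\<close> can be evaluated both in the residue field and in its algebraic
  closure.\<close>

locale field_over_int = field R for R (structure) +
  fixes \<phi> :: "int \<Rightarrow> 'a" and p :: nat
  assumes phi_closed [simp, intro]: "\<phi> a \<in> carrier R"
    and phi_add: "\<phi> (a + b) = \<phi> a \<oplus> \<phi> b"
    and phi_mult: "\<phi> (a * b) = \<phi> a \<otimes> \<phi> b"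
    and phi_1: "\<phi> 1 = \<one>"
    and phi_eq_0_iff: "\<phi> a = \<zero> \<longleftrightarrow> int p dvd a"
begin

lemma phi_0 [simp]: "\<phi> 0 = \<zero>"
  by (simp add: phi_eq_0_iff)

lemma phi_minus: "\<phi> (- a) = \<ominus> \<phi> a"
proof -
  have "\<phi> (- a) \<oplus> \<phi> a = \<zero>"
    using phi_add[of "- a" a] by simp
  then show ?thesis
    by (simp add: minus_equality)
qed

lemma phi_diff: "\<phi> (a - b) = \<phi> a \<ominus> \<phi> b"
  using phi_add[of a "- b"] by (simp add: phi_minus minus_eq)

lemma phi_eq_iff: "\<phi> a = \<phi> b \<longleftrightarrow> int p dvd a - b"
  using phi_eq_0_iff[of "a - b"] by (simp add: phi_diff)

lemma add_pow_eq_phi: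
  assumes "x \<in> carrier R" shows "[n] \<cdot> x = \<phi> (int n) \<otimes> x"
  using assms by (induction n) (simp_all add: phi_add phi_1 l_distr a_comm)

text \<open>\<open>tpoly_eval\<close> sums over the exact support, which shrinks when coefficients
  cancel or become 0 modulo p; over one common finite set, sums can be added termwise.\<close>

lemma tpoly_eval_superset:
  assumes "finite M" "{m. c m \<noteq> 0} \<subseteq> M" "x \<in> carrier R" "y \<in> carrier R" "z \<in> carrier R"
  shows "tpoly_eval R (\<phi> \<circ> c) (x, y, z) =
    (\<Oplus>m \<in> M. \<phi> (c m) \<otimes> (x [^] count m CX \<otimes> y [^] count m CY \<otimes> z [^] count m CZ))"
  unfolding tpoly_eval_def split
  by (rule add.finprod_mono_neutral_cong_left) (use assms in \<open>auto simp: phi_0\<close>)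

fun form_eval :: "int_form \<Rightarrow> 'a \<Rightarrow> 'a \<Rightarrow> 'a \<Rightarrow> 'a" where
  "form_eval [] x y z = \<zero>"
| "form_eval ((a, i, j, k) # Q) x y z =
     \<phi> a \<otimes> (x [^] i \<otimes> y [^] j \<otimes> z [^] k) \<oplus> form_eval Q x y z"

lemma form_eval_closed [simp]:
  "\<lbrakk>x \<in> carrier R; y \<in> carrier R; z \<in> carrier R\<rbrakk> \<Longrightarrow> form_eval Q x y z \<in> carrier R"
  by (induction Q x y z rule: form_eval.induct) auto

lemma tpoly_eval_form:
  assumes "x \<in> carrier R" "y \<in> carrier R" "z \<in> carrier R"
  shows "tpoly_eval R (\<phi> \<circ> form_coeff Q) (x, y, z) = form_eval Q x y z"
proof (induction Q)
  case Nil
  then show ?case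
    using assms by (subst tpoly_eval_superset[of "{}"]) auto
next
  case (Cons q Q)
  obtain a i j k where q: "q = (a, i, j, k)"
    by (cases q) auto
  let ?mon = "\<lambda>m. x [^] count m CX \<otimes> y [^] count m CY \<otimes> z [^] count m CZ"
  let ?m0 = "monomial_mset i j k"
  define M where "M = insert ?m0 {m. form_coeff Q m \<noteq> 0}"
  have M: "finite M" "{m. form_coeff (q # Q) m \<noteq> 0} \<subseteq> M" "{m. form_coeff Q m \<noteq> 0} \<subseteq> M" "?m0 \<in> M"
    using finite_form_coeff_support[of Q] by (auto simp: M_def q split: if_splits)
  have "tpoly_eval R (\<phi> \<circ> form_coeff (q # Q)) (x, y, z) =
      (\<Oplus>m \<in> M. \<phi> (form_coeff (q # Q) m) \<otimes> ?mon m)"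
    by (rule tpoly_eval_superset) (use M assms in auto)
  also have "\<dots> = (\<Oplus>m \<in> M. (if ?m0 = m then \<phi> a \<otimes> ?mon m else \<zero>) \<oplus> \<phi> (form_coeff Q m) \<otimes> ?mon m)"
    by (rule finsum_cong') (use assms in \<open>auto simp: q phi_add l_distr\<close>)
  also have "\<dots> = (\<Oplus>m \<in> M. if ?m0 = m then \<phi> a \<otimes> ?mon m else \<zero>) \<oplus>
      (\<Oplus>m \<in> M. \<phi> (form_coeff Q m) \<otimes> ?mon m)"
    by (rule finsum_addf) (use assms in auto)
  also have "(\<Oplus>m \<in> M. if ?m0 = m then \<phi> a \<otimes> ?mon m else \<zero>) = \<phi> a \<otimes> ?mon ?m0"
    by (rule add.finprod_singleton) (use M assms in auto)
  also have "(\<Oplus>m \<in> M. \<phi> (form_coeff Q m) \<otimes> ?mon m) = tpoly_eval R (\<phi> \<circ> form_coeff Q) (x, y, z)"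
    by (rule tpoly_eval_superset[symmetric]) (use M assms in auto)
  finally show ?case
    using Cons by (simp add: q)
qed

lemma tpoly_deriv_form:
  "tpoly_deriv R c (\<phi> \<circ> form_coeff Q) = \<phi> \<circ> form_coeff (map (term_deriv c) Q)"
  unfolding tpoly_deriv_def fun_eq_iff o_def form_coeff_deriv phi_mult
  by (blast intro: add_pow_eq_phi phi_closed)

lemma form_eval_append:
  assumes "x \<in> carrier R" "y \<in> carrier R" "z \<in> carrier R"
  shows "form_eval (Q @ Q') x y z = form_eval Q x y z \<oplus> form_eval Q' x y z"
  using assms by (induction Q x y z rule: form_eval.induct) (auto simp: a_assoc)

lemma form_eval_scale:
  assumes "\<forall>(a, i, j, k) \<in> set Q. i + j + k = d"
    and "c \<in> carrier R" "x \<in> carrier R" "y \<in> carrier R" "z \<in> carrier R"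
  shows "form_eval Q (c \<otimes> x) (c \<otimes> y) (c \<otimes> z) = c [^] d \<otimes> form_eval Q x y z"
  using assms(1)
proof (induction Q)
  case (Cons q Q)
  obtain a i j k where q: "q = (a, i, j, k)"
    by (cases q) auto
  have d: "d = i + j + k"
    using Cons.prems by (auto simp: q)
  show ?case
    using Cons assms(2-)
    by (simp add: q d nat_pow_distrib nat_pow_mult[symmetric] r_distr m_ac)
qed (use assms in auto)

lemma form_eval_eq_0:
  assumes "x \<in> carrier R" "y \<in> carrier R" "z \<in> carrier R"
    and "\<forall>(a, i, j, k) \<in> set Q. \<phi> a = \<zero> \<or> x [^] i = \<zero> \<or> y [^] j = \<zero> \<or> z [^] k = \<zero>"
  shows "form_eval Q x y z = \<zero>"
  using assms(4)
proof (induction Q)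
  case (Cons q Q)
  then show ?case using assms(1-3) by (cases q) auto
qed auto

end

section \<open>Integer polynomials over a field\<close>

context field_over_int
begin

text \<open>Coefficients stay integers until evaluation: derivatives, compositions and degrees are
  computed in \<open>int poly\<close>, and only values are reduced modulo p.\<close>

definition int_poly_eval :: "int poly \<Rightarrow> 'a \<Rightarrow> 'a" where
  "int_poly_eval P x = fold_coeffs (\<lambda>a s. \<phi> a \<oplus> x \<otimes> s) P \<zero>"

lemma int_poly_eval_0 [simp]: "int_poly_eval 0 x = \<zero>"
  by (simp add: int_poly_eval_def)

lemma int_poly_eval_pCons [simp]:
  assumes "x \<in> carrier R"
  shows "int_poly_eval (pCons a P) x = \<phi> a \<oplus> x \<otimes> int_poly_eval P x"
  using assms by (cases "a = 0 \<and> P = 0") (auto simp: int_poly_eval_def)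

lemma int_poly_eval_closed [simp]: "x \<in> carrier R \<Longrightarrow> int_poly_eval P x \<in> carrier R"
  by (induction P) auto

lemma int_poly_eval_add:
  assumes "x \<in> carrier R"
  shows "int_poly_eval (P + Q) x = int_poly_eval P x \<oplus> int_poly_eval Q x"
  by (induction P Q rule: poly_induct2) (use assms in \<open>simp_all add: phi_add r_distr a_ac\<close>)

lemma int_poly_eval_smult:
  assumes "x \<in> carrier R"
  shows "int_poly_eval (smult c P) x = \<phi> c \<otimes> int_poly_eval P x"
  by (induction P) (use assms in \<open>simp_all add: phi_mult r_distr m_ac\<close>)

lemma int_poly_eval_diff:
  assumes "x \<in> carrier R"
  shows "int_poly_eval (P - Q) x = int_poly_eval P x \<ominus> int_poly_eval Q x"
proof -
  have "int_poly_eval (P + smult (- 1) Q) x = int_poly_eval P x \<oplus> \<phi> (- 1) \<otimes> int_poly_eval Q x"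
    using assms by (simp only: int_poly_eval_add int_poly_eval_smult)
  then show ?thesis
    using assms by (simp add: phi_minus phi_1 l_minus minus_eq)
qed

lemma int_poly_eval_mult:
  assumes "x \<in> carrier R"
  shows "int_poly_eval (P * Q) x = int_poly_eval P x \<otimes> int_poly_eval Q x"
  by (induction P)
     (use assms in \<open>simp_all add: int_poly_eval_add int_poly_eval_smult l_distr m_assoc\<close>)

lemma int_poly_eval_1 [simp]: "x \<in> carrier R \<Longrightarrow> int_poly_eval 1 x = \<one>"
  by (simp add: one_pCons phi_1)

lemma int_poly_eval_power:
  assumes "x \<in> carrier R"
  shows "int_poly_eval (P ^ n) x = int_poly_eval P x [^] n"
  by (induction n) (use assms in \<open>simp_all add: int_poly_eval_mult m_comm\<close>)

lemma int_poly_eval_monom: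
  assumes "x \<in> carrier R"
  shows "int_poly_eval (Polynomial.monom a n) x = \<phi> a \<otimes> x [^] n"
  by (induction n) (use assms in \<open>simp_all add: monom_0 monom_Suc m_ac\<close>)

lemma int_poly_eval_pcompose:
  assumes "x \<in> carrier R"
  shows "int_poly_eval (pcompose P Q) x = int_poly_eval P (int_poly_eval Q x)"
  by (induction P) (use assms in \<open>simp_all add: pcompose_pCons int_poly_eval_add int_poly_eval_mult\<close>)

lemma int_poly_eval_phi: "int_poly_eval P (\<phi> a) = \<phi> (poly P a)"
  by (induction P) (simp_all add: phi_add phi_mult)

text \<open>Link to the coefficient lists of HOL-Algebra, which start with the leading coefficient,
  hence \<open>rev\<close>; it opens the way to the root bound for such lists.\<close>

lemma int_poly_eval_eq_list_eval:
  assumes "x \<in> carrier R"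
  shows "int_poly_eval P x = eval (map \<phi> (rev (coeffs P))) x"
proof (induction P)
  case (pCons a P)
  have *: "set (map \<phi> (rev (coeffs P))) \<subseteq> carrier R"
    by auto
  with eval_in_carrier[OF * assms] pCons assms show ?case
    by (auto simp: cCons_def eval_append_aux m_comm a_comm)
qed auto

text \<open>One coefficient that survives reduction makes the reduced polynomial nonzero, and
  reduction can only lower the degree. The index \<open>i\<close> is left open because the surviving
  coefficient is the leading one in one application and the constant one in another.\<close>

lemma int_poly_roots_bound:
  assumes "\<not> int p dvd Polynomial.coeff P i"
  shows "finite {x \<in> carrier R. int_poly_eval P x = \<zero>}"
    and "card {x \<in> carrier R. int_poly_eval P x = \<zero>} \<le> Polynomial.degree P"
proof -
  define l where "l = map \<phi> (rev (coeffs P))"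
  \<comment> \<open>\<open>normalize\<close> strips the leading zeros that reduction modulo p may
    create.\<close>
  define q where "q = normalize l"
  have l: "set l \<subseteq> carrier R"
    by (auto simp: l_def)
  then have q: "q \<in> carrier (poly_ring R)"
    using normalize_gives_polynomial[of l "carrier R"] by (simp add: q_def univ_poly_carrier)
  have "Polynomial.coeff P i \<in> set (coeffs P)"
    using assms by (metis dvd_0_right coeff_in_coeffs le_degree coeff_0)
  then have "\<phi> (Polynomial.coeff P i) \<in> set l"
    by (auto simp: l_def)
  moreover have "\<phi> (Polynomial.coeff P i) \<noteq> \<zero>"
    using assms by (simp add: phi_eq_0_iff)
  moreover have "set l \<subseteq> {\<zero>}" if "normalize l = []" for l
    using that by (induction l) (auto split: if_splits)
  ultimately have "q \<noteq> []"
    unfolding q_def by blast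
  then have roots: "{x \<in> carrier R. int_poly_eval P x = \<zero>} = set_mset (roots q)"
    using roots_mem_iff_is_root[OF q] l
    by (auto simp: is_root_def q_def eval_normalize int_poly_eval_eq_list_eval l_def)
  then show "finite {x \<in> carrier R. int_poly_eval P x = \<zero>}"
    by simp
  have "length l \<le> Suc (Polynomial.degree P)"
    by (cases "P = 0") (simp_all add: l_def length_coeffs)
  then have "length q - 1 \<le> Polynomial.degree P"
    using normalize_length_le[of l] by (simp add: q_def)
  then have "size (roots q) \<le> Polynomial.degree P"
    using size_roots_le_degree[OF q] by linarith
  then show "card {x \<in> carrier R. int_poly_eval P x = \<zero>} \<le> Polynomial.degree P"
    unfolding roots by (metis dual_order.trans mset_set_set_mset_msubset size_mset_mono size_mset_set)
qed

end

section \<open>The curve\<close>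

text \<open>The form y f(x, z) - l z g(y, z) of degree n + 1.\<close>

definition curve_form :: "int poly \<Rightarrow> int poly \<Rightarrow> int \<Rightarrow> nat \<Rightarrow> int_form" where
  "curve_form f g l n =
     map (\<lambda>i. (Polynomial.coeff f i, i, 1, n - i)) [0..<Suc n] @
     map (\<lambda>j. (- l * Polynomial.coeff g j, 0, j, Suc n - j)) [0..<Suc n]"

lemma curve_form_homogeneous: "\<forall>(a, i, j, k) \<in> set (curve_form f g l n). i + j + k = Suc n"
  by (auto simp: curve_form_def)

lemma sum_list_monom_coeff:
  assumes "Polynomial.degree P \<le> n"
  shows "(\<Sum>i\<leftarrow>[0..<Suc n]. Polynomial.monom (Polynomial.coeff P i) i) = P"
  using poly_as_sum_of_monoms'[OF assms]
  by (simp only: interv_sum_list_conv_sum_set_nat set_upt atLeast0LessThan lessThan_Suc_atMost)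

lemma sum_list_monom_pderiv:
  fixes P :: "int poly"
  assumes "Polynomial.degree P \<le> n"
  shows "(\<Sum>i\<leftarrow>[0..<Suc n]. Polynomial.monom (int i * Polynomial.coeff P i) (i - 1)) = pderiv P"
proof -
  have "pderiv P = (\<Sum>i\<le>n. Polynomial.monom (int i * Polynomial.coeff P i) (i - 1))"
    by (subst (1) poly_as_sum_of_monoms'[OF assms, symmetric])
       (simp add: higher_pderiv_sum[of 1, simplified] pderiv_monom)
  then show ?thesis
    by (simp only: interv_sum_list_conv_sum_set_nat set_upt atLeast0LessThan lessThan_Suc_atMost)
qed

lemma sum_list_monom_smult:
  "(\<Sum>i\<leftarrow>is. Polynomial.monom (a * c i) (u i)) = smult a (\<Sum>i\<leftarrow>is. Polynomial.monom (c i) (u i))"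
  by (induction "is") (simp_all add: smult_monom smult_add_right)

context field_over_int
begin

text \<open>Setting z = 1 erases the exponents \<open>w i\<close>, so the two halves of
  \<open>curve_form\<close> and of its derivatives turn into polynomials in one variable.\<close>

lemma form_eval_map_x:
  assumes "x \<in> carrier R" "y \<in> carrier R"
  shows "form_eval (map (\<lambda>i. (c i, u i, j, w i)) is) x y \<one> =
    y [^] j \<otimes> int_poly_eval (\<Sum>i\<leftarrow>is. Polynomial.monom (c i) (u i)) x"
  by (induction "is") (use assms in
      \<open>simp_all add: int_poly_eval_add int_poly_eval_monom r_distr m_ac\<close>)

lemma form_eval_map_y:
  assumes "x \<in> carrier R" "y \<in> carrier R"
  shows "form_eval (map (\<lambda>i. (c i, 0, u i, w i)) is) x y \<one> =
    int_poly_eval (\<Sum>i\<leftarrow>is. Polynomial.monom (c i) (u i)) y"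
  by (induction "is") (use assms in \<open>simp_all add: int_poly_eval_add int_poly_eval_monom\<close>)

context
  fixes f g :: "int poly" and l :: int and n :: nat
  assumes deg_f: "Polynomial.degree f = n" and deg_g: "Polynomial.degree g = n"
begin

lemma curve_eval_affine:
  assumes "x \<in> carrier R" "y \<in> carrier R"
  shows "form_eval (curve_form f g l n) x y \<one> =
    y \<otimes> int_poly_eval f x \<ominus> \<phi> l \<otimes> int_poly_eval g y"
proof -
  have "(\<Sum>j\<leftarrow>[0..<Suc n]. Polynomial.monom (- l * Polynomial.coeff g j) j) = smult (- l) g"
    using deg_g by (simp only: sum_list_monom_smult sum_list_monom_coeff order_refl)
  moreover have "(\<Sum>j\<leftarrow>[0..<Suc n]. Polynomial.monom (Polynomial.coeff f j) j) = f"
    using deg_f by (simp only: sum_list_monom_coeff order_refl)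
  ultimately show ?thesis
    unfolding curve_form_def using assms
    by (simp only: form_eval_append form_eval_map_x form_eval_map_y int_poly_eval_smult phi_minus
        nat_pow_eone one_closed l_minus minus_eq int_poly_eval_closed phi_closed)
qed

lemma curve_deriv_x_affine:
  assumes "x \<in> carrier R" "y \<in> carrier R"
  shows "form_eval (map (term_deriv CX) (curve_form f g l n)) x y \<one> = y \<otimes> int_poly_eval (pderiv f) x"
proof -
  have "(\<Sum>j\<leftarrow>[0..<Suc n]. Polynomial.monom (int j * Polynomial.coeff f j) (j - 1)) = pderiv f"
    using deg_f by (simp only: sum_list_monom_pderiv order_refl)
  \<comment> \<open>The second half of the form is free of x, so each of its entries acquires the
    factor 0.\<close>
  moreover have "form_eval (map (\<lambda>j. (int 0 * (- l * Polynomial.coeff g j), 0 - 1, j, Suc n - j)) [0..<Suc n]) x y \<one> = \<zero>"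
    by (rule form_eval_eq_0) (use assms in auto)
  ultimately show ?thesis
    unfolding curve_form_def map_append map_map o_def term_deriv.simps using assms
    by (simp only: form_eval_append form_eval_map_x
        nat_pow_eone one_closed r_zero m_closed int_poly_eval_closed)
qed

lemma curve_deriv_y_affine:
  assumes "x \<in> carrier R" "y \<in> carrier R"
  shows "form_eval (map (term_deriv CY) (curve_form f g l n)) x y \<one> =
    int_poly_eval f x \<ominus> \<phi> l \<otimes> int_poly_eval (pderiv g) y"
proof -
  have "(\<Sum>j\<leftarrow>[0..<Suc n]. Polynomial.monom (int 1 * Polynomial.coeff f j) j) = f"
    using deg_f by (simp only: sum_list_monom_coeff order_refl of_nat_1 mult_1)
  moreover have "(\<Sum>j\<leftarrow>[0..<Suc n]. Polynomial.monom (int j * (- l * Polynomial.coeff g j)) (j - 1)) =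
      smult (- l) (pderiv g)"
    using deg_g by (simp only: mult.left_commute[of "int _"] sum_list_monom_smult sum_list_monom_pderiv order_refl)
  ultimately show ?thesis
    unfolding curve_form_def map_append map_map o_def term_deriv.simps using assms
    by (simp only: form_eval_append form_eval_map_x form_eval_map_y int_poly_eval_smult phi_minus
        nat_pow_0 l_one diff_self_eq_0 one_closed l_minus minus_eq int_poly_eval_closed phi_closed)
qed

text \<open>On z = 0 only entries free of z survive. The second half has exponents
  \<open>Suc n - j\<close> of z, all at least 1, so only the entry x^n y of the first half is
  left.\<close>

lemma curve_eval_infinity:
  assumes "x \<in> carrier R" "y \<in> carrier R"
  shows "form_eval (curve_form f g l n) x y \<zero> = \<phi> (Polynomial.lead_coeff f) \<otimes> (x [^] n \<otimes> y)"
proof -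
  have "form_eval (map (\<lambda>i. (Polynomial.coeff f i, i, 1, n - i)) [0..<n]) x y \<zero> = \<zero>"
    by (rule form_eval_eq_0) (use assms in \<open>auto simp: nat_pow_zero\<close>)
  moreover have "form_eval (map (\<lambda>j. (- l * Polynomial.coeff g j, 0, j, Suc n - j)) [0..<Suc n]) x y \<zero> = \<zero>"
    by (rule form_eval_eq_0) (use assms in \<open>auto simp: nat_pow_zero\<close>)
  ultimately show ?thesis
    using assms by (simp add: curve_form_def form_eval_append deg_f del: upt_Suc)
      (simp add: form_eval_append deg_f)
qed

text \<open>For monic \<open>f\<close> this derivative is nonzero at [1:0:0].\<close>

lemma curve_deriv_y_infinity:
  assumes "x \<in> carrier R" "0 < n"
  shows "form_eval (map (term_deriv CY) (curve_form f g l n)) x \<zero> \<zero> = \<phi> (Polynomial.lead_coeff f) \<otimes> x [^] n"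
proof -
  have "form_eval (map (\<lambda>i. (int 1 * Polynomial.coeff f i, i, 1 - 1, n - i)) [0..<n]) x \<zero> \<zero> = \<zero>"
    by (rule form_eval_eq_0) (use assms in \<open>auto simp: nat_pow_zero\<close>)
  moreover have "form_eval (map (\<lambda>j. (int j * (- l * Polynomial.coeff g j), 0, j - 1, Suc n - j)) [0..<Suc n]) x \<zero> \<zero> = \<zero>"
    by (rule form_eval_eq_0) (use assms in \<open>auto simp: nat_pow_zero\<close>)
  ultimately show ?thesis
    unfolding curve_form_def map_append map_map o_def term_deriv.simps
    using assms by (simp add: form_eval_append deg_f del: upt_Suc)
      (simp add: form_eval_append deg_f)
qed

text \<open>For monic \<open>g\<close> and l nonzero in the field this derivative is nonzero at
  [0:1:0]: the entry j = n of the second half is linear in z.\<close>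

lemma curve_deriv_z_infinity:
  assumes "y \<in> carrier R" "2 \<le> n"
  shows "form_eval (map (term_deriv CZ) (curve_form f g l n)) \<zero> y \<zero> =
    \<phi> (- l * Polynomial.lead_coeff g) \<otimes> y [^] n"
proof -
  have "form_eval (map (\<lambda>i. (int (n - i) * Polynomial.coeff f i, i, 1, n - i - 1)) [0..<Suc n]) \<zero> y \<zero> = \<zero>"
  proof (rule form_eval_eq_0)
    \<comment> \<open>A term x^i y z^(n-i-1) could survive at x = z = 0 only for i = 0 and n = 1,
      which n >= 2 excludes.\<close>
    have "\<zero> [^] i = \<zero> \<or> \<zero> [^] (n - i - 1) = \<zero>" for i :: nat
      using assms by (cases "i = 0") (auto simp: nat_pow_zero)
    then show "\<forall>(a, i, j, k) \<in> set (map (\<lambda>i. (int (n - i) * Polynomial.coeff f i, i, 1, n - i - 1)) [0..<Suc n]).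
        \<phi> a = \<zero> \<or> \<zero> [^] i = \<zero> \<or> y [^] j = \<zero> \<or> \<zero> [^] k = \<zero>"
      by fastforce
  qed (use assms in auto)
  moreover have "form_eval (map (\<lambda>j. (int (Suc n - j) * (- l * Polynomial.coeff g j), 0, j, Suc n - j - 1)) [0..<n]) \<zero> y \<zero> = \<zero>"
    by (rule form_eval_eq_0) (use assms in \<open>auto simp: nat_pow_zero\<close>)
  ultimately show ?thesis
    unfolding curve_form_def map_append map_map o_def term_deriv.simps
    using assms by (simp add: form_eval_append deg_f deg_g del: upt_Suc)
      (simp add: form_eval_append deg_g)
qed

end

end

section \<open>Integer forms as plane curves\<close>

context ring
begin

definition term_poly :: "'a \<Rightarrow> coord multiset \<Rightarrow> coord multiset \<Rightarrow> 'a" where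
  "term_poly a m = (\<lambda>m'. if m' = m then a else \<zero>)"

text \<open>\<open>indexed_pset\<close> is generated by constants, sums and multiplication by one
  variable, hence the induction on the multiset \<open>m\<close>.\<close>

lemma term_poly_in_indexed_pset:
  assumes "a \<in> carrier R"
  shows "term_poly a m \<in> indexed_pset UNIV (carrier R)"
proof (induction m)
  case empty
  have "term_poly a {#} = indexed_const a"
    by (simp add: term_poly_def indexed_const_def)
  then show ?case
    using assms by (simp add: indexed_pset.indexed_const)
next
  case (add c m)
  have "term_poly a (add_mset c m) = indexed_pmult (term_poly a m) c"
    by (auto simp: term_poly_def indexed_pmult_def fun_eq_iff)
  then show ?case
    using add by (simp add: indexed_pset.indexed_pmult)
qed

end

text \<open>This coefficient certifies that the form is nonzero: x^n y occurs in a single entry,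
  since the second half has x-exponent 0.\<close>

lemma form_coeff_curve_form:
  assumes "0 < n"
  shows "form_coeff (curve_form f g l n) (monomial_mset n 1 0) = Polynomial.coeff f n"
proof -
  have eq_iff: "monomial_mset i j k = monomial_mset i' j' k' \<longleftrightarrow> i = i' \<and> j = j' \<and> k = k'"
    for i j k i' j' k'
    by (metis count_monomial_mset)
  have append: "form_coeff (Q @ Q') m = form_coeff Q m + form_coeff Q' m" for Q Q' m
    by (induction Q m rule: form_coeff.induct) auto
  have zero: "form_coeff Q m = 0" if "\<forall>(a, i, j, k) \<in> set Q. m \<noteq> monomial_mset i j k" for Q m
    using that by (induction Q m rule: form_coeff.induct) auto
  have "form_coeff (map (\<lambda>i. (Polynomial.coeff f i, i, 1, n - i)) [0..<n]) (monomial_mset n 1 0) = 0"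
    by (rule zero) (auto simp: eq_iff)
  moreover have "form_coeff (map (\<lambda>j. (- l * Polynomial.coeff g j, 0, j, Suc n - j)) [0..<Suc n])
      (monomial_mset n 1 0) = 0"
    by (rule zero) (use assms in \<open>auto simp: eq_iff\<close>)
  ultimately show ?thesis
    by (simp add: curve_form_def append del: upt_Suc) (simp add: append)
qed

context field_over_int
begin

lemma pow_eq_0_imp_eq_0: "x \<in> carrier R \<Longrightarrow> x [^] (k :: nat) = \<zero> \<Longrightarrow> x = \<zero>"
  by (induction k) (auto simp: integral_iff)

lemma minus_eq_0_iff: "a \<in> carrier R \<Longrightarrow> \<ominus> a = \<zero> \<longleftrightarrow> a = \<zero>"
  by (metis minus_minus minus_zero)

text \<open>\<open>i\<close> is the inverse of \<open>b\<close>, and the factor after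
  \<open>b\<close> is the y that solves a x + b y + c = 0. Exchanging the roles of a and b gives the
  point of the line on y = 0.\<close>

lemma line_equation_solution:
  assumes "a \<in> carrier R" "b \<in> carrier R" "c \<in> carrier R" "x \<in> carrier R" "i \<in> carrier R"
    and "b \<otimes> i = \<one>"
  shows "a \<otimes> x \<oplus> b \<otimes> (\<ominus> (i \<otimes> a) \<otimes> x \<oplus> \<ominus> (i \<otimes> c)) \<oplus> c = \<zero>"
proof -
  have "b \<otimes> (\<ominus> (i \<otimes> a) \<otimes> x \<oplus> \<ominus> (i \<otimes> c)) = \<ominus> ((b \<otimes> i) \<otimes> (a \<otimes> x \<oplus> c))"
    using assms(1-5) by algebra
  also have "\<dots> = \<ominus> (a \<otimes> x \<oplus> c)"
    using assms by simp
  finally have "a \<otimes> x \<oplus> b \<otimes> (\<ominus> (i \<otimes> a) \<otimes> x \<oplus> \<ominus> (i \<otimes> c)) \<oplus> c = a \<otimes> x \<oplus> \<ominus> (a \<otimes> x \<oplus> c) \<oplus> c"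
    by simp
  also have "\<dots> = \<zero>"
    using assms(1-5) by algebra
  finally show ?thesis .
qed

lemma form_in_ternary_polys: "\<phi> \<circ> form_coeff Q \<in> ternary_polys R"
proof (induction Q)
  case Nil
  have "\<phi> \<circ> form_coeff [] = indexed_const \<zero>"
    by (auto simp: indexed_const_def fun_eq_iff)
  then show ?case
    by (metis ternary_polys_def indexed_pset.indexed_const zero_closed)
next
  case (Cons q Q)
  obtain a i j k where q: "q = (a, i, j, k)"
    by (cases q) auto
  have "\<phi> \<circ> form_coeff (q # Q) =
      indexed_padd (term_poly (\<phi> a) (monomial_mset i j k)) (\<phi> \<circ> form_coeff Q)"
    by (auto simp: q indexed_padd_def term_poly_def phi_add fun_eq_iff)
  then show ?case
    using Cons unfolding ternary_polys_def
    by (simp only: indexed_pset.indexed_padd term_poly_in_indexed_pset phi_closed)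
qed

lemma plane_curve_form:
  assumes "\<forall>(a, i, j, k) \<in> set Q. i + j + k = d" "\<phi> (form_coeff Q m) \<noteq> \<zero>"
  shows "plane_curve R d (\<phi> \<circ> form_coeff Q)"
proof -
  have "\<phi> \<circ> form_coeff Q \<noteq> (\<lambda>_. \<zero>)"
    using assms(2) by (metis comp_apply)
  moreover have "homogeneous R d (\<phi> \<circ> form_coeff Q)"
    unfolding homogeneous_def
  proof (intro allI impI)
    fix m assume "(\<phi> \<circ> form_coeff Q) m \<noteq> \<zero>"
    then have "form_coeff Q m \<noteq> 0"
      by (auto simp del: phi_eq_0_iff)
    then show "size m = d"
      using form_coeff_homogeneous[OF assms(1)] by simp
  qed
  ultimately show ?thesis
    using form_in_ternary_polys by (simp add: plane_curve_def)
qed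

text \<open>All scalars c are kept because this is also applied to lists of derivatives: these
  contain entries with coefficient 0 whose exponents have the wrong sum, so
  \<open>form_eval_scale\<close> does not cover them.\<close>

lemma vanishes_at_form_iff:
  assumes "x \<in> carrier R" "y \<in> carrier R" "z \<in> carrier R"
  shows "vanishes_at R (\<phi> \<circ> form_coeff Q) (proj_point R (x, y, z)) \<longleftrightarrow>
    (\<forall>c \<in> carrier R - {\<zero>}. form_eval Q (c \<otimes> x) (c \<otimes> y) (c \<otimes> z) = \<zero>)"
proof -
  have "tpoly_eval R (\<phi> \<circ> form_coeff Q) (c \<otimes> x, c \<otimes> y, c \<otimes> z) =
      form_eval Q (c \<otimes> x) (c \<otimes> y) (c \<otimes> z)" if "c \<in> carrier R" for c
    using that assms by (simp add: tpoly_eval_form)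
  moreover have "vanishes_at R (\<phi> \<circ> form_coeff Q) (proj_point R (x, y, z)) \<longleftrightarrow>
      (\<forall>c \<in> carrier R - {\<zero>}. tpoly_eval R (\<phi> \<circ> form_coeff Q) (c \<otimes> x, c \<otimes> y, c \<otimes> z) = \<zero>)"
    unfolding vanishes_at_def proj_point_def split by blast
  ultimately show ?thesis
    by simp
qed

lemma vanishes_at_homogeneous_form_iff:
  assumes "\<forall>(a, i, j, k) \<in> set Q. i + j + k = d"
    and "x \<in> carrier R" "y \<in> carrier R" "z \<in> carrier R"
  shows "vanishes_at R (\<phi> \<circ> form_coeff Q) (proj_point R (x, y, z)) \<longleftrightarrow> form_eval Q x y z = \<zero>"
proof -
  have "form_eval Q x y z = \<zero>" if "\<forall>c \<in> carrier R - {\<zero>}. c [^] d \<otimes> form_eval Q x y z = \<zero>"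
    using that[rule_format, of \<one>] assms by simp
  then show ?thesis
    using assms by (auto simp: vanishes_at_form_iff form_eval_scale[OF assms(1)])
qed

section \<open>Smoothness and blocking property of the curve\<close>

context
  fixes f g :: "int poly" and l :: int and n :: nat
  assumes deg_f: "Polynomial.degree f = n" and deg_g: "Polynomial.degree g = n"
    and monic_f: "Polynomial.lead_coeff f = 1" and monic_g: "Polynomial.lead_coeff g = 1"
    and n_ge_2: "2 \<le> n" and l_nonzero: "\<phi> l \<noteq> \<zero>" and g_0: "int_poly_eval g \<zero> \<noteq> \<zero>"
begin

text \<open>At infinity the curve has only the points [1:0:0] and [0:1:0], where the derivative by y
  or by z is nonzero. In the chart z = 1 a singular point satisfies f'(x) = 0, f(x) = l g'(y) and y
  g'(y) = g(y) with f(x) nonzero, which \<open>no_collision\<close> forbids.\<close>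

lemma curve_smooth:
  assumes separable: "\<And>y. \<lbrakk>y \<in> carrier R; int_poly_eval g y = \<zero>\<rbrakk> \<Longrightarrow> int_poly_eval (pderiv g) y \<noteq> \<zero>"
    and no_collision: "\<And>x y. \<lbrakk>x \<in> carrier R; y \<in> carrier R; int_poly_eval (pderiv f) x = \<zero>;
      int_poly_eval f x \<noteq> \<zero>; y \<otimes> int_poly_eval (pderiv g) y = int_poly_eval g y\<rbrakk> \<Longrightarrow>
      int_poly_eval f x \<noteq> \<phi> l \<otimes> int_poly_eval (pderiv g) y"
    and P: "P \<in> curve_points R (\<phi> \<circ> form_coeff (curve_form f g l n))"
  shows "\<exists>c. \<not> vanishes_at R (tpoly_deriv R c (\<phi> \<circ> form_coeff (curve_form f g l n))) P"
proof (rule ccontr)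
  let ?Q = "curve_form f g l n"
  assume contr: "\<not> ?thesis"
  obtain x0 y0 z0 where P_eq: "P = proj_point R (x0, y0, z0)"
    and x0: "x0 \<in> carrier R" and y0: "y0 \<in> carrier R" and z0: "z0 \<in> carrier R"
    and nonzero: "x0 \<noteq> \<zero> \<or> y0 \<noteq> \<zero> \<or> z0 \<noteq> \<zero>"
    using P by (auto simp: curve_points_def proj_plane_def nonzero_triples_def)
  have curve: "form_eval ?Q (c \<otimes> x0) (c \<otimes> y0) (c \<otimes> z0) = \<zero>"
    if "c \<in> carrier R" "c \<noteq> \<zero>" for c
    using P vanishes_at_form_iff[OF x0 y0 z0] that by (auto simp: curve_points_def P_eq)
  have deriv: "form_eval (map (term_deriv i) ?Q) (c \<otimes> x0) (c \<otimes> y0) (c \<otimes> z0) = \<zero>"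
    if "c \<in> carrier R" "c \<noteq> \<zero>" for c i
    using contr vanishes_at_form_iff[OF x0 y0 z0] that by (auto simp: P_eq tpoly_deriv_form)
  show False
  proof (cases "z0 = \<zero>")
    case True
    have "form_eval ?Q x0 y0 \<zero> = \<zero>"
      using curve[of \<one>] True x0 y0 by simp
    then have "x0 [^] n \<otimes> y0 = \<zero>"
      using x0 y0 monic_f by (simp add: curve_eval_infinity[OF deg_f deg_g] phi_1)
    then have "x0 [^] n = \<zero> \<or> y0 = \<zero>"
      using x0 y0 by (simp add: integral_iff)
    then show False
    proof
      assume "y0 = \<zero>"
      moreover have "form_eval (map (term_deriv CY) ?Q) x0 y0 \<zero> = \<zero>"
        using deriv[of \<one>] True x0 y0 by simp
      ultimately have "x0 [^] n = \<zero>"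
        using curve_deriv_y_infinity[OF deg_f deg_g x0] n_ge_2 monic_f x0 by (simp add: phi_1)
      then show False
        using nonzero True \<open>y0 = \<zero>\<close> x0 pow_eq_0_imp_eq_0 by blast
    next
      assume "x0 [^] n = \<zero>"
      then have "x0 = \<zero>"
        using x0 pow_eq_0_imp_eq_0 by blast
      moreover have "form_eval (map (term_deriv CZ) ?Q) x0 y0 \<zero> = \<zero>"
        using deriv[of \<one>] True x0 y0 by simp
      ultimately have "\<phi> l \<otimes> y0 [^] n = \<zero>"
        using curve_deriv_z_infinity[OF deg_f deg_g y0] n_ge_2 monic_g y0
        by (simp add: phi_minus l_minus)
      then have "y0 [^] n = \<zero>"
        using l_nonzero y0 by (simp add: integral_iff)
      then show False
        using nonzero True \<open>x0 = \<zero>\<close> y0 pow_eq_0_imp_eq_0 by blast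
    qed
  next
    case False
    \<comment> \<open>Rescaling by the inverse of z0 moves the point into the chart z = 1.\<close>
    define c where "c = inv z0"
    have c: "c \<in> carrier R" "c \<otimes> z0 = \<one>"
      using False z0 by (auto simp: c_def field_Units)
    then have "c \<noteq> \<zero>"
      using z0 by auto
    define x y where "x = c \<otimes> x0" and "y = c \<otimes> y0"
    have xy: "x \<in> carrier R" "y \<in> carrier R"
      using c x0 y0 by (auto simp: x_def y_def)
    have "form_eval ?Q x y \<one> = \<zero>" "\<And>i. form_eval (map (term_deriv i) ?Q) x y \<one> = \<zero>"
      using curve[OF c(1) \<open>c \<noteq> \<zero>\<close>] deriv[OF c(1) \<open>c \<noteq> \<zero>\<close>] c(2) by (auto simp: x_def y_def)
    then have eqs: "y \<otimes> int_poly_eval f x = \<phi> l \<otimes> int_poly_eval g y"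
        "y \<otimes> int_poly_eval (pderiv f) x = \<zero>"
        "int_poly_eval f x = \<phi> l \<otimes> int_poly_eval (pderiv g) y"
      using xy curve_eval_affine[OF deg_f deg_g xy, of l] curve_deriv_x_affine[OF deg_f deg_g xy, of l]
        curve_deriv_y_affine[OF deg_f deg_g xy, of l]
      by (metis int_poly_eval_closed m_closed phi_closed r_right_minus_eq)+
    \<comment> \<open>With y = 0 the first equation would read 0 = l g(0).\<close>
    have "\<phi> l \<otimes> int_poly_eval g \<zero> \<noteq> \<zero>"
      using g_0 l_nonzero by (simp add: integral_iff)
    then have "y \<noteq> \<zero>"
      using eqs(1) xy by auto
    then have 1: "int_poly_eval (pderiv f) x = \<zero>"
      using eqs(2) xy by (simp add: integral_iff)
    have "\<phi> l \<otimes> (y \<otimes> int_poly_eval (pderiv g) y) = \<phi> l \<otimes> int_poly_eval g y"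
      using eqs(1,3) xy by (simp add: m_lcomm)
    then have 2: "y \<otimes> int_poly_eval (pderiv g) y = int_poly_eval g y"
      using l_nonzero xy by (simp add: m_lcancel)
    \<comment> \<open>If g'(y) were 0, then g(y) = y g'(y) = 0, so y would be a multiple root of
      g.\<close>
    have "int_poly_eval (pderiv g) y \<noteq> \<zero>"
      using separable[OF xy(2)] 2 xy by auto
    then have "int_poly_eval f x \<noteq> \<zero>"
      using eqs(3) l_nonzero xy by (simp add: integral_iff)
    with no_collision[OF xy 1 _ 2] eqs(3) show False
      by blast
  qed
qed

text \<open>A line with a = 0 passes through [1:0:0], one with b = 0 through [0:1:0], and both
  points lie on the curve. Any other line has the form y = a' x + b' and is met by
  \<open>hits\<close> in a point with f(x) = g(y) = 0.\<close>

lemma curve_nontrivially_blocking: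
  assumes hits: "\<And>a b. \<lbrakk>a \<in> carrier R; a \<noteq> \<zero>; b \<in> carrier R\<rbrakk> \<Longrightarrow>
      \<exists>x \<in> carrier R. int_poly_eval f x = \<zero> \<and> int_poly_eval g (a \<otimes> x \<oplus> b) = \<zero>"
    and f_0: "int_poly_eval f \<zero> \<noteq> \<zero>"
  shows "nontrivially_blocking R (\<phi> \<circ> form_coeff (curve_form f g l n))"
proof -
  let ?Q = "curve_form f g l n"
  let ?C = "curve_points R (\<phi> \<circ> form_coeff ?Q)"
  have on_curve: "proj_point R (x, y, z) \<in> ?C \<longleftrightarrow> form_eval ?Q x y z = \<zero>"
    if "(x, y, z) \<in> nonzero_triples R" for x y z
    using that vanishes_at_homogeneous_form_iff[OF curve_form_homogeneous]
    by (auto simp: curve_points_def proj_plane_def nonzero_triples_def)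
  have affine: "form_eval ?Q x y \<one> = y \<otimes> int_poly_eval f x \<ominus> \<phi> l \<otimes> int_poly_eval g y"
    if "x \<in> carrier R" "y \<in> carrier R" for x y
    using that by (rule curve_eval_affine[OF deg_f deg_g])
  have infinity: "form_eval ?Q x y \<zero> = x [^] n \<otimes> y"
    if "x \<in> carrier R" "y \<in> carrier R" for x y
    using that monic_f by (simp add: curve_eval_infinity[OF deg_f deg_g] phi_1)
  have "L \<inter> ?C \<noteq> {} \<and> \<not> L \<subseteq> ?C" if L_line: "L \<in> proj_lines R" for L
  proof -
    obtain a b c where L: "L = proj_line R (a, b, c)" and abc: "a \<in> carrier R" "b \<in> carrier R" "c \<in> carrier R"
      and abc_nonzero: "a \<noteq> \<zero> \<or> b \<noteq> \<zero> \<or> c \<noteq> \<zero>"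
      using L_line by (auto simp: proj_lines_def nonzero_triples_def)
    have in_L: "proj_point R (x, y, z) \<in> L"
      if "(x, y, z) \<in> nonzero_triples R" "a \<otimes> x \<oplus> b \<otimes> y \<oplus> c \<otimes> z = \<zero>" for x y z
      using that by (auto simp: L proj_line_def)
    have blocked: "L \<inter> ?C \<noteq> {}"
      if "(x, y, z) \<in> nonzero_triples R" "a \<otimes> x \<oplus> b \<otimes> y \<oplus> c \<otimes> z = \<zero>" "form_eval ?Q x y z = \<zero>"
      for x y z
      using in_L on_curve that by blast
    have not_contained: "\<not> L \<subseteq> ?C"
      if "(x, y, z) \<in> nonzero_triples R" "a \<otimes> x \<oplus> b \<otimes> y \<oplus> c \<otimes> z = \<zero>" "form_eval ?Q x y z \<noteq> \<zero>"
      for x y z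
      using in_L on_curve that by blast
    have inverse: "\<exists>i. i \<in> carrier R \<and> u \<otimes> i = \<one> \<and> i \<noteq> \<zero>" if "u \<in> carrier R" "u \<noteq> \<zero>" for u
      using that by (intro exI[of _ "inv u"]) (metis DiffI Units_inv_closed Units_r_inv field_Units one_not_zero r_null singletonD)
    have "L \<inter> ?C \<noteq> {}"
    proof (cases "a = \<zero> \<or> b = \<zero>")
      case True
      then show ?thesis
      proof
        assume "a = \<zero>"
        then show ?thesis
          using abc by (intro blocked[of \<one> \<zero> \<zero>]) (auto simp: nonzero_triples_def infinity)
      next
        assume "b = \<zero>"
        then show ?thesis
          using abc n_ge_2
          by (intro blocked[of \<zero> \<one> \<zero>]) (auto simp: nonzero_triples_def infinity nat_pow_zero)
      qed
    next
      case False
      then obtain i where i: "i \<in> carrier R" "b \<otimes> i = \<one>" "i \<noteq> \<zero>"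
        using inverse abc by blast
      define a' b' where "a' = \<ominus> (i \<otimes> a)" and "b' = \<ominus> (i \<otimes> c)"
      have "i \<otimes> a \<noteq> \<zero>"
        using False abc i by (simp add: integral_iff)
      then have a'b': "a' \<in> carrier R" "a' \<noteq> \<zero>" "b' \<in> carrier R"
        using abc i by (auto simp: a'_def b'_def minus_eq_0_iff)
      obtain x where x: "x \<in> carrier R" "int_poly_eval f x = \<zero>" "int_poly_eval g (a' \<otimes> x \<oplus> b') = \<zero>"
        using hits[OF a'b'] by auto
      have "a \<otimes> x \<oplus> b \<otimes> (a' \<otimes> x \<oplus> b') \<oplus> c \<otimes> \<one> = \<zero>"
        using line_equation_solution[OF abc x(1) i(1,2)] abc by (simp add: a'_def b'_def)
      moreover have "form_eval ?Q x (a' \<otimes> x \<oplus> b') \<one> = \<zero>"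
        using x a'b' by (simp add: affine minus_eq)
      ultimately show ?thesis
        using x a'b' by (intro blocked[of x "a' \<otimes> x \<oplus> b'" \<one>]) (auto simp: nonzero_triples_def)
    qed
    moreover have "\<not> L \<subseteq> ?C"
    proof (cases "a = \<zero>")
      case False
      then obtain i where i: "i \<in> carrier R" "a \<otimes> i = \<one>"
        using inverse abc by blast
      have "b \<otimes> \<zero> \<oplus> a \<otimes> (\<ominus> (i \<otimes> b) \<otimes> \<zero> \<oplus> \<ominus> (i \<otimes> c)) \<oplus> c = \<zero>"
        using abc i by (intro line_equation_solution) auto
      then have "a \<otimes> (\<ominus> (i \<otimes> c)) \<oplus> b \<otimes> \<zero> \<oplus> c \<otimes> \<one> = \<zero>"
        using abc i by simp
      \<comment> \<open>On y = 0 the affine equation reduces to -l g(0), which is nonzero.\<close>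
      moreover have "form_eval ?Q (\<ominus> (i \<otimes> c)) \<zero> \<one> \<noteq> \<zero>"
        using abc i l_nonzero g_0 by (simp add: affine minus_eq minus_eq_0_iff integral_iff)
      ultimately show ?thesis
        using abc i by (intro not_contained[of "\<ominus> (i \<otimes> c)" \<zero> \<one>]) (auto simp: nonzero_triples_def)
    next
      case a: True
      show ?thesis
      proof (cases "b = \<zero>")
        case True
        with a abc_nonzero abc show ?thesis
          by (intro not_contained[of \<one> \<one> \<zero>]) (auto simp: nonzero_triples_def infinity)
      next
        case False
        then obtain i where i: "i \<in> carrier R" "b \<otimes> i = \<one>"
          using inverse abc by blast
        define y where "y = \<ominus> (i \<otimes> c)"
        have y: "y \<in> carrier R"
          using i abc by (simp add: y_def)
        have "a \<otimes> x \<oplus> b \<otimes> y \<oplus> c \<otimes> \<one> = \<zero>" if "x \<in> carrier R" for x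
          using line_equation_solution[OF abc that i] a abc i that by (simp add: y_def)
        then have *: "\<not> L \<subseteq> ?C" if "x \<in> carrier R"
          "y \<otimes> int_poly_eval f x \<ominus> \<phi> l \<otimes> int_poly_eval g y \<noteq> \<zero>" for x
          using that y by (intro not_contained[of x y \<one>]) (auto simp: nonzero_triples_def affine)
        \<comment> \<open>On a line y = const the equation is y f(x) - l g(y). If g(y) = 0, then y
          is nonzero and x = 0 leaves y f(0); otherwise a root x of f, supplied by
          \<open>hits\<close>, leaves -l g(y).\<close>
        show ?thesis
        proof (cases "int_poly_eval g y = \<zero>")
          case True
          then have "y \<noteq> \<zero>"
            using g_0 by auto
          with True show ?thesis
            using f_0 y by (intro *[of \<zero>]) (auto simp: minus_eq minus_eq_0_iff integral_iff)
        next
          case False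
          obtain x where "x \<in> carrier R" "int_poly_eval f x = \<zero>"
            using hits[of \<one> \<zero>] by auto
          with False show ?thesis
            using l_nonzero y by (intro *[of x]) (auto simp: minus_eq minus_eq_0_iff integral_iff)
        qed
      qed
    qed
    ultimately show ?thesis ..
  qed
  moreover have "?C \<subseteq> proj_plane R"
    by (auto simp: curve_points_def)
  ultimately show ?thesis
    by (simp add: nontrivially_blocking_def nontrivial_blocking_set_def blocking_set_def)
qed

end

end

section \<open>Critical values\<close>

lemma degree_prod_linear: "Polynomial.degree (\<Prod>b\<in>B. [:- b, 1:] :: int poly) = card B"
  by (induction B rule: infinite_finite_induct) (simp_all add: degree_mult_eq del: mult_pCons_left)

lemma lead_coeff_prod_linear: "Polynomial.lead_coeff (\<Prod>b\<in>B. [:- b, 1:] :: int poly) = 1"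
  by (simp add: lead_coeff_prod)

context field_over_int
begin

text \<open>A bad l yields a pair of a value in \<open>V\<close> and a point in \<open>W\<close>.
  Since the value is nonzero, the pair determines l modulo p, so at most m n of the p - 1 candidates
  are bad.\<close>

lemma multiplier_without_collision:
  assumes "prime p" and V: "finite V" "\<zero> \<notin> V" "card V \<le> m" and W: "finite W" "card W \<le> n"
    and closed: "\<And>w. w \<in> W \<Longrightarrow> G w \<in> carrier R" and "m * n < p - 1"
  shows "\<exists>l \<in> {1..<p}. \<forall>w \<in> W. \<phi> (int l) \<otimes> G w \<notin> V"
proof (rule ccontr)
  assume "\<not> ?thesis"
  then have "\<exists>w \<in> W. \<phi> (int l) \<otimes> G w \<in> V" if "l \<in> {1..<p}" for l
    using that by blast
  then obtain w where w: "\<And>l. l \<in> {1..<p} \<Longrightarrow> w l \<in> W \<and> \<phi> (int l) \<otimes> G (w l) \<in> V"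
    by metis
  have "inj_on (\<lambda>l. (\<phi> (int l) \<otimes> G (w l), w l)) {1..<p}"
  proof (rule inj_onI)
    fix l l' assume l: "l \<in> {1..<p}" and l': "l' \<in> {1..<p}"
      and eq: "(\<phi> (int l) \<otimes> G (w l), w l) = (\<phi> (int l') \<otimes> G (w l'), w l')"
    have "\<phi> (int l) \<otimes> G (w l) \<noteq> \<zero>"
      using w[OF l] V by auto
    then have "G (w l) \<noteq> \<zero>" "G (w l) \<in> carrier R"
      using closed w[OF l] by auto
    with eq have "\<phi> (int l) = \<phi> (int l')"
      using m_rcancel by auto
    then have "[int l = int l'] (mod int p)"
      by (simp add: phi_eq_iff cong_iff_dvd_diff)
    then show "l = l'"
      using l l' by (auto simp: cong_int_iff intro: cong_less_modulus_unique_nat)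
  qed
  then have "card {1..<p} \<le> card (V \<times> W)"
    by (rule card_inj_on_le) (use w V W in auto)
  also have "\<dots> \<le> m * n"
    using V W by (simp add: card_cartesian_product mult_le_mono)
  finally show False
    using \<open>m * n < p - 1\<close> by simp
qed

text \<open>Substituting x^r and taking the e-th power leave the number of nonzero critical values at
  the degree of h, however large the degree of the resulting polynomial becomes.\<close>

lemma critical_values_power_pcompose_monom:
  fixes h :: "int poly"
  assumes "Polynomial.lead_coeff h = 1" "0 < Polynomial.degree h" "\<not> p dvd Polynomial.degree h"
    and "\<not> p dvd r" "\<not> p dvd e"
  defines "f \<equiv> pcompose h (Polynomial.monom 1 r) ^ e"
  defines "V \<equiv> {int_poly_eval f x | x. x \<in> carrier R \<and> int_poly_eval (pderiv f) x = \<zero> \<and> int_poly_eval f x \<noteq> \<zero>}"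
  shows "finite V" "card V \<le> Polynomial.degree h"
proof -
  \<comment> \<open>The coefficient of h' at \<open>k\<close> is the degree of h, which p does not
    divide, so h' has at most \<open>degree h - 1\<close> roots. Adjoining 0 to them accounts for
    the factor x^(r-1) of the derivative.\<close>
  define k where "k = Polynomial.degree h - 1"
  define S where "S = insert \<zero> {s \<in> carrier R. int_poly_eval (pderiv h) s = \<zero>}"
  have "Polynomial.coeff (pderiv h) k = int (Polynomial.degree h)"
    using assms by (simp add: coeff_pderiv k_def)
  then have *: "\<not> int p dvd Polynomial.coeff (pderiv h) k"
    using assms by simp
  have S: "finite S" "card S \<le> Polynomial.degree h"
    using int_poly_roots_bound[OF *] assms unfolding S_def
    by (auto simp: degree_pderiv card_insert_if)
  have f: "int_poly_eval f x = int_poly_eval h (x [^] r) [^] e" if "x \<in> carrier R" for x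
    using that by (simp add: f_def int_poly_eval_power int_poly_eval_pcompose int_poly_eval_monom phi_1)
  have "V \<subseteq> (\<lambda>s. int_poly_eval h s [^] e) ` S"
  proof
    fix v assume "v \<in> V"
    then obtain x where x: "v = int_poly_eval f x" "x \<in> carrier R" "int_poly_eval (pderiv f) x = \<zero>"
      "int_poly_eval f x \<noteq> \<zero>"
      by (auto simp: V_def)
    have deriv: "int_poly_eval (pderiv f) x = \<phi> (int e) \<otimes> (int_poly_eval h (x [^] r) [^] (e - 1) \<otimes>
        (int_poly_eval (pderiv h) (x [^] r) \<otimes> (\<phi> (int r) \<otimes> x [^] (r - 1))))"
      using x by (simp add: f_def pderiv_power pderiv_pcompose pderiv_monom int_poly_eval_smult
          int_poly_eval_mult int_poly_eval_power int_poly_eval_pcompose int_poly_eval_monom phi_1)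
    have nonzero: "\<phi> (int e) \<noteq> \<zero>" "\<phi> (int r) \<noteq> \<zero>"
      using assms by (simp_all add: phi_eq_0_iff)
    \<comment> \<open>Zeros of h(x^r) are critical points as soon as e > 1, but their critical value
      is 0 and \<open>V\<close> leaves it out.\<close>
    have power_nonzero: "int_poly_eval h (x [^] r) [^] (e - 1) \<noteq> \<zero>"
    proof
      assume "int_poly_eval h (x [^] r) [^] (e - 1) = \<zero>"
      then have "int_poly_eval h (x [^] r) = \<zero>"
        using x(2) pow_eq_0_imp_eq_0[of "int_poly_eval h (x [^] r)" "e - 1"] by auto
      moreover have "e \<noteq> 0"
        using assms by (cases e) auto
      ultimately show False
        using x f by (simp add: nat_pow_zero)
    qed
    have "int_poly_eval (pderiv h) (x [^] r) = \<zero> \<or> x [^] (r - 1) = \<zero>"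
      using x(3)[unfolded deriv] nonzero power_nonzero x(2)
      by (simp only: integral_iff m_closed phi_closed int_poly_eval_closed nat_pow_closed) auto
    moreover have "x [^] r = \<zero>" if "x [^] (r - 1) = \<zero>"
    proof -
      have "x = \<zero>"
        using pow_eq_0_imp_eq_0[OF x(2) that] .
      moreover have "r \<noteq> 0"
        using assms by (cases r) auto
      ultimately show ?thesis
        by (simp add: nat_pow_zero)
    qed
    ultimately have "x [^] r \<in> S"
      using x by (auto simp: S_def)
    then show "v \<in> (\<lambda>s. int_poly_eval h s [^] e) ` S"
      using x f by auto
  qed
  then show "finite V" "card V \<le> Polynomial.degree h"
    using S by (auto intro: finite_subset) (meson card_image_le card_mono finite_imageI le_trans)
qed

section \<open>Products of distinct linear factors modulo p\<close>

context
  fixes B :: "int set" and g :: "int poly"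
  assumes prime_p: "prime p" and finite_B: "finite B" and B: "B \<subseteq> {1..<int p}"
  defines "g \<equiv> \<Prod>b\<in>B. [:- b, 1:]"
begin

lemma prod_linear_root_iff:
  assumes "y \<in> carrier R"
  shows "int_poly_eval g y = \<zero> \<longleftrightarrow> y \<in> \<phi> ` B"
proof -
  have linear: "int_poly_eval [:- b, 1:] y = \<zero> \<longleftrightarrow> y = \<phi> b" for b
    using assms r_right_minus_eq[of y "\<phi> b"] by (simp add: phi_minus phi_1 minus_eq a_comm)
  from finite_B show ?thesis
    unfolding g_def
  proof (induction B rule: finite_induct)
    case (insert b B)
    have "int_poly_eval (\<Prod>b\<in>insert b B. [:- b, 1:]) y =
        int_poly_eval [:- b, 1:] y \<otimes> int_poly_eval (\<Prod>b\<in>B. [:- b, 1:]) y"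
      by (subst prod.insert)
         (use insert assms in \<open>simp_all add: int_poly_eval_mult del: mult_pCons_left\<close>)
    then show ?case
      using insert.IH assms linear[of b]
      by (simp only: integral_iff int_poly_eval_closed image_insert insert_iff)
  qed (use assms in auto)
qed

text \<open>At a root b the derivative is the product of the differences b - b', none of which p
  divides because \<open>B\<close> lies in {1..<p}.\<close>

lemma prod_linear_separable:
  assumes "y \<in> carrier R" "int_poly_eval g y = \<zero>"
  shows "int_poly_eval (pderiv g) y \<noteq> \<zero>"
proof -
  obtain b where b: "b \<in> B" "y = \<phi> b"
    using assms prod_linear_root_iff by auto
  define q where "q = (\<Prod>b'\<in>B - {b}. [:- b', 1:])"
  have g: "g = [:- b, 1:] * q"
    using b finite_B by (simp add: g_def q_def prod.remove)
  have "poly (pderiv g) b = (\<Prod>b'\<in>B - {b}. b - b')"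
    by (simp add: g pderiv_mult pderiv_pCons q_def poly_prod del: mult_pCons_left)
  moreover have "\<not> int p dvd b - b'" if "b' \<in> B - {b}" for b'
  proof -
    have "b \<in> {1..<int p}" "b' \<in> {1..<int p}"
      using that b B by blast+
    then have "\<bar>b - b'\<bar> < int p" "b - b' \<noteq> 0"
      using that by auto
    then show ?thesis
      by (metis dvd_imp_le_int abs_of_nat not_le)
  qed
  ultimately have "\<not> int p dvd poly (pderiv g) b"
    using prime_p finite_B by (simp add: prime_dvd_prod_iff)
  then show ?thesis
    by (simp add: b int_poly_eval_phi phi_eq_0_iff)
qed

lemma prod_linear_0: "\<not> int p dvd poly g 0"
proof -
  have "\<not> int p dvd b" if "b \<in> B" for b
    using that B zdvd_not_zless[of b "int p"] by auto
  then show ?thesis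
    using prime_p finite_B by (simp add: g_def poly_prod prime_dvd_prod_iff)
qed

text \<open>\<open>W\<close> is the zero set of y g'(y) - g(y). Its constant coefficient -g(0)
  survives reduction, whereas its coefficient of degree \<open>card B\<close> is
  \<open>card B - 1\<close> and may be 0.\<close>

lemma prod_linear_tangents:
  defines "W \<equiv> {y \<in> carrier R. y \<otimes> int_poly_eval (pderiv g) y = int_poly_eval g y}"
  shows "finite W" "card W \<le> card B"
proof -
  define P where "P = pCons 0 (pderiv g) - g"
  have "Polynomial.coeff P 0 = - poly g 0"
    by (simp add: P_def poly_0_coeff_0)
  then have *: "\<not> int p dvd Polynomial.coeff P 0"
    using prod_linear_0 by simp
  have W: "W = {y \<in> carrier R. int_poly_eval P y = \<zero>}"
    by (auto simp: W_def P_def int_poly_eval_diff)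
  have "Polynomial.degree (pCons 0 (pderiv g)) \<le> card B"
    by (cases "pderiv g = 0")
       (auto simp: degree_pderiv g_def degree_prod_linear pderiv_eq_0_iff)
  then have "Polynomial.degree P \<le> card B"
    unfolding P_def by (rule degree_diff_le) (simp add: g_def degree_prod_linear)
  then show "finite W" "card W \<le> card B"
    using int_poly_roots_bound[OF *] unfolding W by auto
qed

end

end

section \<open>The residue field, its closure, and assembly of the curve\<close>

lemma field_over_int_residue_ring:
  assumes "prime p"
  shows "field_over_int (residue_ring (int p)) (\<lambda>a. a mod int p) p"
proof -
  interpret residues_prime p "residue_ring (int p)"
    by unfold_locales (use assms in auto)
  show ?thesis
    by unfold_locales
       (auto simp: add_cong mult_cong one_cong zero_cong simp del: mod_in_carrier)
qed

text \<open>\<open>indexed_const\<close> is an injective homomorphism, so composing with it keeps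
  the kernel of \<open>\<phi>\<close>.\<close>

lemma field_over_int_alg_closure:
  assumes "field_over_int K \<phi> p"
  shows "field_over_int (field.alg_closure K) (ring.indexed_const K \<circ> \<phi>) p"
proof -
  interpret K: field_over_int K \<phi> p
    by fact
  interpret L: algebraic_closure K.alg_closure "K.indexed_const ` carrier K"
    by (rule K.alg_closureE)
  interpret hom: ring_hom_ring K K.alg_closure K.indexed_const
    by (rule ring_hom_ringI2) (use K.alg_closureE(2) K.ring_axioms L.ring_axioms in auto)
  have "K.indexed_const (\<phi> a) = \<zero>\<^bsub>K.alg_closure\<^esub> \<longleftrightarrow> int p dvd a" for a
    by (metis K.indexed_const_is_inj injD hom.hom_zero K.phi_eq_0_iff)
  then show ?thesis
    by unfold_locales (auto simp: K.phi_add K.phi_mult K.phi_1)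
qed

text \<open>Smoothness lives over the closure \<open>L\<close> and blocking over the residue field
  \<open>K\<close>, with the same integer polynomials \<open>f\<close> and \<open>g\<close>. The
  bounds on m keep p from dividing the degree of \<open>h\<close>, and m n < p - 1 leaves a suitable
  multiplier l.\<close>

theorem curve_from_hitting_set:
  fixes T Y :: "int set"
  assumes p: "prime p" and T: "finite T" "card T = m" "\<forall>t\<in>T. \<not> int p dvd t"
    and m: "0 < m" "m < p" and r: "\<not> p dvd r" and e: "\<not> p dvd e"
    and n: "n = r * m * e" "2 \<le> n" "m * n < p - 1"
    and Y: "Y \<subseteq> {1..<int p}" "card Y = n"
    and hits: "\<And>a b. \<lbrakk>a \<in> {1..<int p}; b \<in> {0..<int p}\<rbrakk> \<Longrightarrow>
      \<exists>x. (\<exists>t\<in>T. [x ^ r = t] (mod int p)) \<and> (a * x + b) mod int p \<in> Y"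
  shows "\<exists>F. plane_curve (residue_ring (int p)) (n + 1) F \<and>
    smooth_curve (residue_ring (int p)) F \<and> nontrivially_blocking (residue_ring (int p)) F"
proof -
  define K where "K = residue_ring (int p)"
  define L where "L = field.alg_closure K"
  define \<phi> where "\<phi> = (\<lambda>a. a mod int p)"
  define \<psi> :: "int \<Rightarrow> (int list \<times> nat) multiset \<Rightarrow> int" where "\<psi> = ring.indexed_const K \<circ> \<phi>"
  interpret K: field_over_int K \<phi> p
    unfolding K_def \<phi>_def by (rule field_over_int_residue_ring) fact
  interpret L: field_over_int L \<psi> p
    unfolding L_def \<psi>_def by (rule field_over_int_alg_closure) (rule K.field_over_int_axioms)
  define h where "h = (\<Prod>t\<in>T. [:- t, 1:])"
  define f where "f = pcompose h (Polynomial.monom 1 r) ^ e"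
  define g where "g = (\<Prod>b\<in>Y. [:- b, 1:])"
  have finite_Y: "finite Y"
    using Y(1) finite_subset by auto
  have r_pos: "0 < r"
    using r by (cases r) auto
  have h: "Polynomial.degree h = m" "Polynomial.lead_coeff h = 1"
    unfolding h_def by (simp add: degree_prod_linear T, rule lead_coeff_prod_linear)
  have hr: "Polynomial.degree (pcompose h (Polynomial.monom 1 r)) = m * r"
    "Polynomial.lead_coeff (pcompose h (Polynomial.monom 1 r)) = 1"
    using h r_pos lead_coeff_comp[of "Polynomial.monom 1 r" h]
    by (simp_all add: degree_pcompose degree_monom_eq)
  have f: "Polynomial.degree f = n" "Polynomial.lead_coeff f = 1"
  proof -
    have "pcompose h (Polynomial.monom 1 r) \<noteq> 0"
      using hr(2) by auto
    then show "Polynomial.degree f = n"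
      using hr(1) n(1) by (simp add: f_def degree_power_eq mult_ac)
    show "Polynomial.lead_coeff f = 1"
      unfolding f_def lead_coeff_power hr(2) by simp
  qed
  have g: "Polynomial.degree g = n" "Polynomial.lead_coeff g = 1"
    unfolding g_def by (simp add: degree_prod_linear Y, rule lead_coeff_prod_linear)
  have poly_f: "poly f x = (\<Prod>t\<in>T. x ^ r - t) ^ e" for x
    by (simp add: f_def h_def poly_pcompose poly_prod poly_monom)
  \<comment> \<open>Critical values and tangency points are collected over the closure, where
    smoothness is tested; l is still sought in {1..<p}, so the form keeps its coefficients in the
    residue field.\<close>
  define V where "V = {L.int_poly_eval f x | x. x \<in> carrier L \<and>
    L.int_poly_eval (pderiv f) x = \<zero>\<^bsub>L\<^esub> \<and> L.int_poly_eval f x \<noteq> \<zero>\<^bsub>L\<^esub>}"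
  define W where "W = {y \<in> carrier L. y \<otimes>\<^bsub>L\<^esub> L.int_poly_eval (pderiv g) y = L.int_poly_eval g y}"
  have "\<not> p dvd m"
    using m by auto
  then have V: "finite V" "card V \<le> m"
    using L.critical_values_power_pcompose_monom[of h r e] h m r e unfolding V_def f_def by auto
  have W: "finite W" "card W \<le> n"
    using L.prod_linear_tangents[OF p finite_Y Y(1)] Y(2) unfolding W_def g_def by auto
  have "\<exists>l\<in>{1..<p}. \<forall>w\<in>W. \<psi> (int l) \<otimes>\<^bsub>L\<^esub> L.int_poly_eval (pderiv g) w \<notin> V"
    by (rule L.multiplier_without_collision[where m = m and n = n])
       (use p V W n in \<open>auto simp: V_def W_def\<close>)
  then obtain l where l: "l \<in> {1..<p}"
    "\<And>w. w \<in> W \<Longrightarrow> \<psi> (int l) \<otimes>\<^bsub>L\<^esub> L.int_poly_eval (pderiv g) w \<notin> V"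
    by auto
  have l_nonzero: "\<not> int p dvd int l"
    using l(1) by (auto dest: dvd_imp_le)
  define F where "F = \<phi> \<circ> form_coeff (curve_form f g (int l) n)"
  have poly_g_0: "\<not> int p dvd poly g 0"
    unfolding g_def using K.prod_linear_0[OF p finite_Y Y(1)] .
  have "plane_curve K (Suc n) F"
    unfolding F_def
  proof (rule K.plane_curve_form[OF curve_form_homogeneous])
    show "\<phi> (form_coeff (curve_form f g (int l) n) (monomial_mset n 1 0)) \<noteq> \<zero>\<^bsub>K\<^esub>"
    proof (subst form_coeff_curve_form)
      show "0 < n"
        using n(2) by simp
      show "\<phi> (Polynomial.coeff f n) \<noteq> \<zero>\<^bsub>K\<^esub>"
        using f K.one_not_zero by (simp add: K.phi_1)
    qed
  qed
  moreover have "smooth_curve K F"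
  proof -
    have F: "ring.indexed_const K \<circ> F = \<psi> \<circ> form_coeff (curve_form f g (int l) n)"
      by (simp add: F_def \<psi>_def comp_assoc)
    have "\<exists>c. \<not> vanishes_at L (tpoly_deriv L c (\<psi> \<circ> form_coeff (curve_form f g (int l) n))) P"
      if P: "P \<in> curve_points L (\<psi> \<circ> form_coeff (curve_form f g (int l) n))" for P
    proof (rule L.curve_smooth[OF f(1) g(1) f(2) g(2) n(2) _ _ _ _ P])
      show "\<psi> (int l) \<noteq> \<zero>\<^bsub>L\<^esub>"
        using l_nonzero by (simp add: L.phi_eq_0_iff)
      show "L.int_poly_eval g \<zero>\<^bsub>L\<^esub> \<noteq> \<zero>\<^bsub>L\<^esub>"
        using L.int_poly_eval_phi[of g 0] poly_g_0 by (simp add: L.phi_eq_0_iff)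
      show "L.int_poly_eval (pderiv g) y \<noteq> \<zero>\<^bsub>L\<^esub>" if "y \<in> carrier L" "L.int_poly_eval g y = \<zero>\<^bsub>L\<^esub>" for y
        using L.prod_linear_separable[OF p finite_Y Y(1)] that unfolding g_def by blast
    next
      fix x y
      assume "x \<in> carrier L" "y \<in> carrier L" "L.int_poly_eval (pderiv f) x = \<zero>\<^bsub>L\<^esub>"
        "L.int_poly_eval f x \<noteq> \<zero>\<^bsub>L\<^esub>" "y \<otimes>\<^bsub>L\<^esub> L.int_poly_eval (pderiv g) y = L.int_poly_eval g y"
      then show "L.int_poly_eval f x \<noteq> \<psi> (int l) \<otimes>\<^bsub>L\<^esub> L.int_poly_eval (pderiv g) y"
        using l(2)[of y] by (auto simp: V_def W_def)
    qed
    then show ?thesis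
      by (simp add: smooth_curve_def F flip: L_def)
  qed
  moreover have "nontrivially_blocking K F"
    unfolding F_def
  proof (rule K.curve_nontrivially_blocking[OF f(1) g(1) f(2) g(2) n(2)])
    show "\<phi> (int l) \<noteq> \<zero>\<^bsub>K\<^esub>"
      using l_nonzero by (simp add: K.phi_eq_0_iff)
    show "K.int_poly_eval g \<zero>\<^bsub>K\<^esub> \<noteq> \<zero>\<^bsub>K\<^esub>"
      using K.int_poly_eval_phi[of g 0] poly_g_0 by (simp add: K.phi_eq_0_iff)
    have "prime (int p)"
      using p by simp
    \<comment> \<open>Since f(0) is the e-th power of the product of all -t, it is nonzero because
      \<open>T\<close> avoids the multiples of p.\<close>
    then have "\<not> int p dvd (\<Prod>t\<in>T. 0 ^ r - t)"
      using T r_pos by (simp add: prime_dvd_prod_iff power_0_left)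
    then have "\<not> int p dvd poly f 0"
      unfolding poly_f using \<open>prime (int p)\<close> prime_dvd_power by blast
    then show "K.int_poly_eval f \<zero>\<^bsub>K\<^esub> \<noteq> \<zero>\<^bsub>K\<^esub>"
      using K.int_poly_eval_phi[of f 0] by (simp add: K.phi_eq_0_iff)
  next
    fix a b assume ab: "a \<in> carrier K" "a \<noteq> \<zero>\<^bsub>K\<^esub>" "b \<in> carrier K"
    have "a \<in> {1..<int p}" "b \<in> {0..<int p}" "\<phi> a = a" "\<phi> b = b"
      using ab by (auto simp: K_def residue_ring_def \<phi>_def)
    with hits obtain x t where x: "t \<in> T" "[x ^ r = t] (mod int p)" "(a * x + b) mod int p \<in> Y"
      by blast
    have "int p dvd x ^ r - t"
      using x(2) by (simp add: cong_iff_dvd_diff)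
    then have "int p dvd (\<Prod>t\<in>T. x ^ r - t)"
      using T(1) x(1) by (meson dvd_prodI dvd_trans)
    then have "int p dvd poly f x"
      using e unfolding poly_f by (cases e) auto
    then have "K.int_poly_eval f (\<phi> x) = \<zero>\<^bsub>K\<^esub>"
      by (simp add: K.int_poly_eval_phi K.phi_eq_0_iff)
    moreover have "a \<otimes>\<^bsub>K\<^esub> \<phi> x \<oplus>\<^bsub>K\<^esub> b = \<phi> ((a * x + b) mod int p)"
      by (simp add: K_def residue_ring_def \<phi>_def mod_simps)
    then have "K.int_poly_eval g (a \<otimes>\<^bsub>K\<^esub> \<phi> x \<oplus>\<^bsub>K\<^esub> b) = \<zero>\<^bsub>K\<^esub>"
      using K.prod_linear_root_iff[OF p finite_Y Y(1)] x(3) unfolding g_def by auto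
    ultimately show "\<exists>x\<in>carrier K. K.int_poly_eval f x = \<zero>\<^bsub>K\<^esub> \<and>
        K.int_poly_eval g (a \<otimes>\<^bsub>K\<^esub> x \<oplus>\<^bsub>K\<^esub> b) = \<zero>\<^bsub>K\<^esub>"
      by blast
  qed
  ultimately show ?thesis
    unfolding K_def by auto
qed

section \<open>Hitting sets\<close>

text \<open>Double counting of the pairs (u, i) with u outside S i: each i lies in at most
  \<open>card U - s\<close> of them, so some u misses at most the average number of sets.\<close>

lemma exists_frequent_point:
  assumes U: "finite U" "U \<noteq> {}" and I: "finite I"
    and S: "\<And>i. i \<in> I \<Longrightarrow> S i \<subseteq> U \<and> s \<le> card (S i)"
  shows "\<exists>u \<in> U. card U * card {i \<in> I. u \<notin> S i} \<le> (card U - s) * card I"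
proof (rule ccontr)
  assume "\<not> ?thesis"
  then have "(\<Sum>u\<in>U. (card U - s) * card I) < (\<Sum>u\<in>U. card U * card {i \<in> I. u \<notin> S i})"
    using U by (intro sum_strict_mono) auto
  also have "\<dots> = card U * (\<Sum>u\<in>U. card {i \<in> I. u \<notin> S i})"
    by (simp add: sum_distrib_left)
  also have "(\<Sum>u\<in>U. card {i \<in> I. u \<notin> S i}) = (\<Sum>i\<in>I. card {u \<in> U. u \<notin> S i})"
    by (rule sum_multicount_gen) (use U I in auto)
  also have "\<dots> \<le> (\<Sum>i\<in>I. card U - s)"
  proof (rule sum_mono)
    fix i assume "i \<in> I"
    then have "card {u \<in> U. u \<notin> S i} = card U - card (S i)"
      using S U by (metis card_Diff_subset finite_subset set_diff_eq)
    then show "card {u \<in> U. u \<notin> S i} \<le> card U - s"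
      using S[OF \<open>i \<in> I\<close>] by (simp add: diff_le_mono2)
  qed
  finally show False
    by (simp add: mult_ac)
qed

text \<open>Greedy choice: each further point shrinks the family of sets not yet hit by the factor 1
  - s / card U. Clearing denominators keeps the estimate in the naturals.\<close>

lemma exists_partial_hitting_set:
  assumes U: "finite U" "U \<noteq> {}" and I: "finite I"
    and S: "\<And>i. i \<in> I \<Longrightarrow> S i \<subseteq> U \<and> s \<le> card (S i)"
  shows "\<exists>Y \<subseteq> U. card Y \<le> k \<and>
    card U ^ k * card {i \<in> I. S i \<inter> Y = {}} \<le> (card U - s) ^ k * card I"
proof (induction k)
  case 0
  show ?case
    by (intro exI[of _ "{}"]) auto
next
  case (Suc k)
  then obtain Y where Y: "Y \<subseteq> U" "card Y \<le> k"
    "card U ^ k * card {i \<in> I. S i \<inter> Y = {}} \<le> (card U - s) ^ k * card I"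
    by auto
  obtain u where u: "u \<in> U"
    "card U * card {i \<in> {i \<in> I. S i \<inter> Y = {}}. u \<notin> S i} \<le> (card U - s) * card {i \<in> I. S i \<inter> Y = {}}"
    using exists_frequent_point[OF U, of "{i \<in> I. S i \<inter> Y = {}}" S s] I S by auto
  have eq: "{i \<in> I. S i \<inter> insert u Y = {}} = {i \<in> {i \<in> I. S i \<inter> Y = {}}. u \<notin> S i}"
    by auto
  have "card U ^ Suc k * card {i \<in> I. S i \<inter> insert u Y = {}} =
      card U ^ k * (card U * card {i \<in> {i \<in> I. S i \<inter> Y = {}}. u \<notin> S i})"
    unfolding eq by (simp only: power_Suc mult_ac)
  also have "\<dots> \<le> card U ^ k * ((card U - s) * card {i \<in> I. S i \<inter> Y = {}})"
    using u by (intro mult_left_mono) auto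
  also have "\<dots> = (card U - s) * (card U ^ k * card {i \<in> I. S i \<inter> Y = {}})"
    by (simp add: mult_ac)
  also have "\<dots> \<le> (card U - s) * ((card U - s) ^ k * card I)"
    using Y by (intro mult_left_mono) auto
  finally have "card U ^ Suc k * card {i \<in> I. S i \<inter> insert u Y = {}} \<le> (card U - s) ^ Suc k * card I"
    by (simp add: mult_ac)
  moreover have "card (insert u Y) \<le> Suc k"
    using Y card_insert_le_m1[of "Suc k" Y u] by simp
  ultimately show ?case
    using u Y by (intro exI[of _ "insert u Y"]) auto
qed

text \<open>After k greedy steps fewer than one set is left unhit, hence none.\<close>

lemma exists_hitting_set:
  assumes U: "finite U" "U \<noteq> {}" and I: "finite I"
    and S: "\<And>i. i \<in> I \<Longrightarrow> S i \<subseteq> U \<and> s \<le> card (S i)"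
    and k: "k \<le> card U" "(card U - s) ^ k * card I < card U ^ k"
  shows "\<exists>Y \<subseteq> U. card Y = k \<and> (\<forall>i \<in> I. S i \<inter> Y \<noteq> {})"
proof -
  obtain Y0 where Y0: "Y0 \<subseteq> U" "card Y0 \<le> k"
    "card U ^ k * card {i \<in> I. S i \<inter> Y0 = {}} \<le> (card U - s) ^ k * card I"
    using exists_partial_hitting_set[where S = S and s = s and k = k, OF U I S] by blast
  have "card U ^ k * card {i \<in> I. S i \<inter> Y0 = {}} < card U ^ k * 1"
    using le_less_trans[OF Y0(3) k(2)] unfolding mult_1_right .
  then have "card {i \<in> I. S i \<inter> Y0 = {}} = 0"
    by (simp only: mult_less_cancel1) auto
  then have "{i \<in> I. S i \<inter> Y0 = {}} = {}"
    using I by simp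
  then have hit: "S i \<inter> Y0 \<noteq> {}" if "i \<in> I" for i
    using that by blast
  \<comment> \<open>Padding to exactly k elements keeps every set hit and fixes the degree of g
    later.\<close>
  obtain Y where Y: "Y0 \<subseteq> Y" "Y \<subseteq> U" "card Y = k"
    using exists_subset_between[OF Y0(2) k(1) Y0(1) U(1)] by metis
  then have "\<forall>i\<in>I. S i \<inter> Y \<noteq> {}"
    using hit by blast
  with Y show ?thesis
    by blast
qed

section \<open>Fibres of the r-th power map and lines meeting a product set\<close>

text \<open>For a primitive root a and p - 1 = r q, taking r-th powers multiplies exponents by r, so
  a^(r i) has the preimages a^(i + k q) with k < r. The first m values of i give \<open>T\<close>
  and \<open>Z\<close>.\<close>

lemma power_fibres:
  assumes p: "prime p" and r: "r dvd p - 1" and m: "r * m \<le> p - 1"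
  obtains T Z :: "int set" where "finite T" "card T = m" "\<forall>t\<in>T. \<not> int p dvd t"
    "Z \<subseteq> {1..<int p}" "card Z = r * m" "\<forall>x\<in>Z. \<exists>t\<in>T. [x ^ r = t] (mod int p)"
proof -
  obtain a where a: "residue_primroot p a"
    using prime_primitive_root_exists[of p] p prime_gt_1_nat by blast
  define E where "E j = int (a ^ j mod p)" for j
  have p1: "1 < p"
    using p prime_gt_1_nat by blast
  have bij: "bij_betw (\<lambda>i. a ^ i mod p) {..<p - 1} (totatives p)"
    using residue_primroot_is_generator[OF p1 a] p by (simp add: totient_prime)
  then have inj: "inj_on E {..<p - 1}"
    unfolding bij_betw_def inj_on_def E_def by auto
  have E_range: "E j \<in> {1..<int p}" if "j < p - 1" for j
  proof -
    have "a ^ j mod p \<in> totatives p"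
      using bij that unfolding bij_betw_def by auto
    then show ?thesis
      using p1 by (auto simp: E_def totatives_def)
  qed
  define q where "q = (p - 1) div r"
  have q: "p - 1 = r * q"
    using r by (simp add: q_def)
  have r_pos: "0 < r"
    using r p1 by (auto intro: Nat.gr0I)
  then have "m \<le> q"
    using m q by auto
  define T where "T = (\<lambda>i. E (r * i)) ` {..<m}"
  define J where "J = (\<lambda>(i, k). i + k * q) ` ({..<m} \<times> {..<r})"
  define Z where "Z = E ` J"
  have J: "J \<subseteq> {..<p - 1}"
  proof
    fix j assume "j \<in> J"
    then obtain i k where "j = i + k * q" "i < m" "k < r"
      by (auto simp: J_def)
    then have "j < Suc k * q"
      using \<open>m \<le> q\<close> by simp
    also have "\<dots> \<le> r * q"
      using \<open>k < r\<close> by (intro mult_right_mono) auto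
    finally show "j \<in> {..<p - 1}"
      using q by simp
  qed
  have "inj_on (\<lambda>(i, k). i + k * q) ({..<m} \<times> {..<r})"
  proof (rule inj_onI, clarify)
    fix i k i' k' assume "i < m" "i' < m" and eq: "i + k * q = i' + k' * q"
    then have "i < q" "i' < q"
      using \<open>m \<le> q\<close> by auto
    then show "i = i' \<and> k = k'"
      using arg_cong[OF eq, of "\<lambda>t. t mod q"] arg_cong[OF eq, of "\<lambda>t. t div q"] by simp
  qed
  then have "card J = r * m"
    by (simp add: J_def card_image)
  then have "card Z = r * m"
    using inj J by (simp add: Z_def card_image inj_on_subset)
  moreover have "Z \<subseteq> {1..<int p}"
    using J E_range by (auto simp: Z_def)
  moreover have T_sub: "(\<lambda>i. r * i) ` {..<m} \<subseteq> {..<p - 1}"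
    using \<open>m \<le> q\<close> r_pos q by auto
  have "card T = m"
  proof -
    have "inj_on (E \<circ> (\<lambda>i. r * i)) {..<m}"
      using r_pos by (intro comp_inj_on[OF _ inj_on_subset[OF inj T_sub]]) (auto simp: inj_on_def)
    then show ?thesis
      by (simp add: T_def card_image o_def)
  qed
  moreover have "\<not> int p dvd t" if "t \<in> T" for t
  proof -
    have "t \<in> {1..<int p}"
      using that T_sub E_range by (auto simp: T_def)
    then show ?thesis
      using zdvd_not_zless[of t "int p"] by auto
  qed
  moreover have "\<exists>t\<in>T. [x ^ r = t] (mod int p)" if zZ: "x \<in> Z" for x
  proof -
    obtain i k where x: "x = E (i + k * q)" "i < m"
      using zZ by (auto simp: Z_def J_def)
    \<comment> \<open>By Fermat the part (p - 1) k of the exponent r (i + k q) disappears.\<close>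
    have "[a ^ ((p - 1) * k) = 1] (mod p)"
    proof -
      have "[(a ^ (p - 1)) ^ k = 1 ^ k] (mod p)"
        using a p by (intro cong_pow fermat_theorem)
          (auto simp: residue_primroot_def prime_imp_coprime coprime_commute coprime_absorb_left p1)
      then show ?thesis
        by (simp add: power_mult)
    qed
    then have "[a ^ (r * i) * a ^ ((p - 1) * k) = a ^ (r * i) * 1] (mod p)"
      by (rule cong_scalar_left)
    moreover have "a ^ (r * i) * a ^ ((p - 1) * k) = (a ^ (i + k * q)) ^ r"
    proof -
      have "r * i + (p - 1) * k = (i + k * q) * r"
        unfolding q by (simp add: algebra_simps)
      then show ?thesis
        by (simp only: flip: power_add power_mult)
    qed
    moreover have "[(a ^ (i + k * q) mod p) ^ r = (a ^ (i + k * q)) ^ r] (mod p)"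
      by (intro cong_pow) simp
    moreover have "[a ^ (r * i) = a ^ (r * i) mod p] (mod p)"
      by (simp add: cong_def)
    ultimately have "[(a ^ (i + k * q) mod p) ^ r = a ^ (r * i) mod p] (mod p)"
      by (metis cong_trans mult.right_neutral)
    then have "[x ^ r = E (r * i)] (mod int p)"
      using x by (simp add: E_def flip: cong_int_iff)
    then show ?thesis
      using x by (auto simp: T_def)
  qed
  ultimately show ?thesis
    using that[of T Z] by (simp add: T_def)
qed

text \<open>The sets to be hit are the images of \<open>Z\<close> under the p (p - 1) maps x -> a x
  + b. Each map is injective modulo p, and discarding 0 from an image costs at most one element,
  whence \<open>card Z - 1\<close>.\<close>

lemma exists_line_hitting_set:
  fixes Z :: "int set"
  assumes p: "prime p" and Z: "Z \<subseteq> {1..<int p}" "Z \<noteq> {}"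
    and n: "n \<le> p - 1" "2 * real (p - 1) * ln (real p) < real n * (real (card Z) - 1)"
  obtains Y where "Y \<subseteq> {1..<int p}" "card Y = n"
    "\<And>a b. \<lbrakk>a \<in> {1..<int p}; b \<in> {0..<int p}\<rbrakk> \<Longrightarrow> \<exists>x\<in>Z. (a * x + b) mod int p \<in> Y"
proof -
  have p1: "1 < p"
    using p prime_gt_1_nat by blast
  define N where "N = p - 1"
  define s where "s = card Z - 1"
  have finite_Z: "finite Z"
    using Z(1) finite_subset by auto
  then have card_Z: "card Z \<le> N" "0 < card Z"
    using card_mono[OF _ Z(1)] Z(2) by (auto simp: N_def card_gt_0_iff)
  let ?U = "{1..<int p}" and ?I = "{1..<int p} \<times> {0..<int p}"
  \<comment> \<open>Discarding 0 keeps \<open>Y\<close> inside {1..<p}, so that g(0) will be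
    nonzero.\<close>
  define S where "S = (\<lambda>(a, b). (\<lambda>x. (a * x + b) mod int p) ` Z - {0})"
  have S: "S i \<subseteq> ?U \<and> s \<le> card (S i)" if i: "i \<in> ?I" for i
  proof -
    obtain a b where ab: "i = (a, b)" "a \<in> {1..<int p}"
      using i by auto
    have "\<not> int p dvd a"
      using ab zdvd_not_zless[of a "int p"] by auto
    then have coprime_a: "coprime a (int p)"
      using p by (metis coprime_commute prime_imp_coprime prime_nat_int_transfer)
    have "inj_on (\<lambda>x. (a * x + b) mod int p) Z"
    proof (rule inj_onI)
      fix x y assume xy: "x \<in> Z" "y \<in> Z" "(a * x + b) mod int p = (a * y + b) mod int p"
      from xy(3) have "[a * x + b = a * y + b] (mod int p)"
        by (simp only: cong_iff_dvd_diff mod_eq_dvd_iff)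
      then have "[x = y] (mod int p)"
        using coprime_a by (simp add: cong_add_rcancel cong_mult_lcancel)
      then show "x = y"
        using xy(1,2) Z(1) by (intro cong_less_imp_eq_int[of x "int p" y]) auto
    qed
    then have "card ((\<lambda>x. (a * x + b) mod int p) ` Z) = card Z"
      by (rule card_image)
    then have "s \<le> card (S i)"
      using card_Diff1_le[of "(\<lambda>x. (a * x + b) mod int p) ` Z" 0]
        diff_card_le_card_Diff[of "{0}" "(\<lambda>x. (a * x + b) mod int p) ` Z"]
      by (simp add: S_def ab s_def)
    moreover have "z mod int p \<in> ?U" if "z mod int p \<noteq> 0" for z
    proof -
      have "0 \<le> z mod int p" "z mod int p < int p"
        using p1 by simp_all
      with that have "1 \<le> z mod int p"
        by linarith
      with \<open>z mod int p < int p\<close> show ?thesis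
        by simp
    qed
    then have "S i \<subseteq> ?U"
      unfolding S_def ab by blast
    ultimately show ?thesis
      by blast
  qed
  \<comment> \<open>From 1 - s/N <= exp (-s/N) and n s / N > 2 ln p, the power (N - s)^n is below
    N^n / p^2, and p^2 exceeds the number N p of pairs.\<close>
  have "(card ?U - s) ^ n * card ?I < card ?U ^ n"
  proof -
    have N: "card ?U = N" "0 < real N" "s \<le> N" "real s = real (card Z) - 1"
      using p1 card_Z by (auto simp: N_def s_def)
    have "real (N - s) = real N * (1 + (- real s / real N))"
      using N by (simp add: field_simps of_nat_diff)
    also have "\<dots> \<le> real N * exp (- real s / real N)"
      using N by (intro mult_left_mono exp_ge_add_one_self) auto
    finally have "real (N - s) ^ n \<le> (real N * exp (- real s / real N)) ^ n"
      by (intro power_mono) auto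
    also have "\<dots> = real N ^ n * exp (- (real n * real s / real N))"
      by (simp add: power_mult_distrib flip: exp_of_nat_mult)
    also have "exp (- (real n * real s / real N)) < exp (- (2 * ln (real p)))"
    proof -
      have "2 * real N * ln (real p) < real n * real s"
        using n(2) unfolding N(4) N_def .
      then have "2 * ln (real p) < real n * real s / real N"
        using N(2) by (simp add: pos_less_divide_eq mult_ac)
      then show ?thesis
        by simp
    qed
    also have "exp (- (2 * ln (real p))) = 1 / real p ^ 2"
      using p1 by (simp add: exp_minus exp_double field_simps)
    finally have less: "real (N - s) ^ n < real N ^ n * (1 / real p ^ 2)"
      using N by simp
    have "real (N - s) ^ n * (real N * real p) \<le> real (N - s) ^ n * real p ^ 2"
      by (intro mult_left_mono) (auto simp: N_def power2_eq_square intro!: mult_right_mono)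
    also have "\<dots> < real N ^ n * (1 / real p ^ 2) * real p ^ 2"
      using less p1 by (intro mult_strict_right_mono) auto
    also have "\<dots> = real N ^ n"
      using p1 by simp
    finally have "real ((N - s) ^ n * (N * p)) < real (N ^ n)"
      by simp
    then show ?thesis
      using p1 by (simp only: of_nat_less_iff) (simp add: N_def card_cartesian_product nat_diff_distrib)
  qed
  moreover have "n \<le> card ?U"
    using n by (simp add: nat_diff_distrib)
  moreover have "1 \<in> ?U"
    using p1 by auto
  ultimately obtain Y where "Y \<subseteq> ?U" "card Y = n" "\<forall>i \<in> ?I. S i \<inter> Y \<noteq> {}"
    using exists_hitting_set[of ?U ?I S s n] S by fastforce
  then show ?thesis
    by (intro that[of Y]) (fastforce simp: S_def)+
qed

section \<open>The primes and the degree\<close>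

text \<open>A prime divisor p of the Fermat number 2^(2^j) + 1 is odd, and 2^(2^j) is -1 modulo p.
  Hence 2 has order exactly 2^(j+1), which divides p - 1.\<close>

lemma fermat_number_prime_divisor:
  obtains p :: nat where "prime p" "2 ^ (j + 1) dvd p - 1" "p - 1 \<le> 2 ^ 2 ^ j"
proof -
  obtain p :: nat where p: "prime p" "p dvd 2 ^ 2 ^ j + 1"
    using prime_factor_nat[of "2 ^ 2 ^ j + 1"] by auto
  have p1: "1 < p"
    using p prime_gt_1_nat by blast
  have "odd ((2 :: nat) ^ 2 ^ j + 1)"
    by simp
  then have "p \<noteq> 2"
    using p(2) by blast
  have not_dvd: "\<not> p dvd 2"
    using \<open>p \<noteq> 2\<close> p1 by (auto dest: dvd_imp_le)
  have not_1: "\<not> [2 ^ 2 ^ j = 1] (mod p)"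
  proof
    assume "[2 ^ 2 ^ j = 1] (mod p)"
    then have "[2 ^ 2 ^ j + 1 = 1 + 1] (mod p)"
      by (rule cong_add) simp
    with p(2) have "p dvd 1 + 1"
      using cong_dvd_iff by blast
    with not_dvd show False
      by (simp add: numeral_2_eq_2)
  qed
  have "[(2 :: int) ^ 2 ^ j = - 1] (mod int p)"
  proof -
    have "int p dvd int (2 ^ 2 ^ j + 1)"
      using p(2) by (simp only: of_nat_dvd_iff)
    then show ?thesis
      by (simp add: cong_iff_dvd_diff add.commute)
  qed
  then have "[((2 :: int) ^ 2 ^ j) ^ 2 = (- 1) ^ 2] (mod int p)"
    by (rule cong_pow)
  then have "[int (2 ^ 2 ^ (j + 1)) = int 1] (mod int p)"
    by (simp add: mult.commute flip: power_mult)
  then have "ord p 2 dvd 2 ^ (j + 1)"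
    by (simp only: cong_int_iff ord_divides)
  then obtain i where i: "i \<le> j + 1" "ord p 2 = 2 ^ i"
    using divides_primepow_nat[OF two_is_prime_nat] by blast
  have "i = j + 1"
  proof (rule ccontr)
    assume "i \<noteq> j + 1"
    then have "ord p 2 dvd 2 ^ j"
      using i by (simp add: le_imp_power_dvd)
    then show False
      using not_1 ord_divides by blast
  qed
  moreover have "ord p 2 dvd p - 1"
    using fermat_theorem[OF p(1) not_dvd] by (simp only: ord_divides)
  moreover have "p \<le> 2 ^ 2 ^ j + 1"
    using p(2) by (intro dvd_imp_le) auto
  ultimately show ?thesis
    using that[of p] p(1) i by simp
qed

text \<open>The window has ratio 2, so it can be met by a power of two. Its lower end, larger than 2
  ln (p - 1) for p > 2, serves the hitting set when m n is close to p; its upper end keeps r m^2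
  small against p.\<close>

definition log_divisor :: "nat \<Rightarrow> nat \<Rightarrow> bool" where
  "log_divisor p r \<longleftrightarrow> r dvd p - 1 \<and>
     2 * log 2 (real (p - 1)) \<le> real r \<and> real r < 4 * log 2 (real (p - 1))"

text \<open>For a prime divisor of a Fermat number, 2^(j+1) divides p - 1 and is at least 2 log_2 (p
  - 1), so the least power of two above that bound also divides p - 1. From p > 2^(j+1) these primes
  are unbounded.\<close>

lemma infinite_primes_log_divisor: "infinite {p. prime p \<and> (\<exists>r. log_divisor p r)}"
proof -
  have "\<exists>p>j. prime p \<and> (\<exists>r. log_divisor p r)" for j
  proof -
    obtain p :: nat where p: "prime p" "2 ^ (j + 1) dvd p - 1" "p - 1 \<le> 2 ^ 2 ^ j"
      by (rule fermat_number_prime_divisor)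
    have "0 < p - 1"
      using prime_gt_1_nat[OF p(1)] by simp
    with p(2) have "2 ^ (j + 1) \<le> p - 1"
      by (rule dvd_imp_le)
    moreover have "j + 1 < (2 :: nat) ^ (j + 1)"
      by (rule less_exp)
    ultimately have "j < p"
      by linarith
    define l where "l = 2 * log 2 (real (p - 1))"
    have "2 \<le> p - 1"
      using \<open>2 ^ (j + 1) \<le> p - 1\<close> order_trans[of 2 "2 ^ (j + 1)" "p - 1"] by simp
    then have "2 \<le> l"
      using log_mono[of 2 2 "real (p - 1)"] by (simp add: l_def)
    have "real (p - 1) \<le> real (2 ^ 2 ^ j)"
      using p(3) by (simp only: of_nat_le_iff)
    then have "log 2 (real (p - 1)) \<le> log 2 (2 ^ 2 ^ j)"
      using \<open>0 < p - 1\<close> by (intro log_mono) auto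
    then have l: "l \<le> 2 ^ (j + 1)"
      by (simp add: l_def log_nat_power)
    \<comment> \<open>Minimality gives 2^(i-1) < l, that is, the upper bound 2^i < 2 l; the case i =
      0 is excluded by l >= 2.\<close>
    define i where "i = (LEAST i. l \<le> 2 ^ i)"
    have i: "l \<le> 2 ^ i" "i \<le> j + 1"
      unfolding i_def by (rule LeastI[of "\<lambda>i. l \<le> 2 ^ i", OF l], rule Least_le, rule l)
    have "i \<noteq> 0"
      using i(1) \<open>2 \<le> l\<close> by (cases i) auto
    then have "\<not> l \<le> 2 ^ (i - 1)"
      using not_less_Least[of "i - 1" "\<lambda>i. l \<le> 2 ^ i"] by (simp add: i_def)
    then have "2 ^ i < 2 * l"
      using \<open>i \<noteq> 0\<close> by (cases i) auto
    moreover have "2 ^ i dvd p - 1"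
      using p(2) i(2) by (meson dvd_trans le_imp_power_dvd)
    ultimately have "log_divisor p (2 ^ i)"
      using i(1) by (simp add: log_divisor_def l_def)
    with p(1) \<open>j < p\<close> show ?thesis
      by blast
  qed
  then show ?thesis
    unfolding infinite_nat_iff_unbounded by simp
qed

section \<open>Asymptotics and the choice of m, e and n\<close>

text \<open>\<open>Q\<close> has order sqrt p log p and is negligible against p. In the last
  inequality the left side is asymptotic to 2 p ln p and the right side to (2 / ln 2) p ln p, and ln
  2 < 1.\<close>

lemma eventually_parameters_large:
  fixes A \<theta> :: real
  assumes "0 < \<theta>" "0 < A"
  defines "Q \<equiv> \<lambda>p. 4 * log 2 p * (A ^ 2 * p powr (1 / 2))"
  shows "eventually (\<lambda>p :: nat. 2 \<le> A * real p powr \<theta> \<and> Q (real p) + 2 \<le> real p / 2 \<and>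
    2 * (real p - 1) * ln (real p) < (real p - 2 - Q (real p)) * (2 * log 2 (real p - 1) - 1)) at_top"
proof -
  have 1: "eventually (\<lambda>p :: nat. 2 \<le> A * real p powr \<theta>) at_top"
    using assms(1,2) by real_asymp
  have 2: "eventually (\<lambda>p :: nat. Q (real p) + 2 \<le> real p / 2) at_top"
    unfolding Q_def using assms(2) by real_asymp
  define c where "c = 1 / ln (2 :: real)"
  have c: "1 < c"
    using ln_2_less_1 by (simp add: c_def)
  define B where "B = A ^ 2"
  have B: "0 < B"
    using assms(2) by (simp add: B_def)
  have lim1: "(\<lambda>p :: nat. 2 * (real p - 1) * ln (real p) / (real p * ln (real p))) \<longlonglongrightarrow> 2"
    by real_asymp
  have lim2: "(\<lambda>p :: nat. (real p - 2 - 4 * (c * ln (real p)) * (B * real p powr (1 / 2))) *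
      (2 * (c * ln (real p - 1)) - 1) / (real p * ln (real p))) \<longlonglongrightarrow> 2 * c"
    using c B by real_asymp
  have pos: "eventually (\<lambda>p :: nat. 0 < real p * ln (real p)) at_top"
    by real_asymp
  have Q: "Q x = 4 * (c * ln x) * (B * x powr (1 / 2))" and log: "log 2 x = c * ln x" for x
    by (simp_all add: Q_def c_def B_def log_def)
  \<comment> \<open>Since c > 1, the number 1 + c separates the two limits 2 and 2 c.\<close>
  have bound1: "eventually (\<lambda>p :: nat. 2 * (real p - 1) * ln (real p) / (real p * ln (real p)) < 1 + c) at_top"
    using order_tendstoD(2)[OF lim1, of "1 + c"] c by simp
  have bound2: "eventually (\<lambda>p :: nat. 1 + c < (real p - 2 - 4 * (c * ln (real p)) * (B * real p powr (1 / 2))) *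
      (2 * (c * ln (real p - 1)) - 1) / (real p * ln (real p))) at_top"
    using order_tendstoD(1)[OF lim2, of "1 + c"] c by simp
  have 3: "eventually (\<lambda>p :: nat. 2 * (real p - 1) * ln (real p)
      < (real p - 2 - Q (real p)) * (2 * log 2 (real p - 1) - 1)) at_top"
    using bound1 bound2 pos
  proof eventually_elim
    case (elim p)
    then have "2 * (real p - 1) * ln (real p) / (real p * ln (real p)) <
        (real p - 2 - 4 * (c * ln (real p)) * (B * real p powr (1 / 2))) *
        (2 * (c * ln (real p - 1)) - 1) / (real p * ln (real p))"
      using c by linarith
    then show ?case
      unfolding Q log using elim(3) by (simp only: divide_less_cancel)
  qed
  show ?thesis
    using 1 2 3 by eventually_elim auto
qed

text \<open>With m about A p^\<theta> and q = r m^2, the largest e with q e <= p - 2 puts m n = q e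
  into (p - 2 - q, p - 2]. Thus m n < p - 1, while n is about p^(1-\<theta>) / A and m n is large
  enough for the hitting set.\<close>

lemma degree_parameters:
  fixes p r :: nat and A \<theta> :: real
  assumes \<theta>: "0 < \<theta>" "\<theta> \<le> 1 / 4" and A: "0 < A" and p: "2 < p" and r: "log_divisor p r"
  defines "Q \<equiv> 4 * log 2 (real p) * (A ^ 2 * real p powr (1 / 2))"
  assumes large: "2 \<le> A * real p powr \<theta>" "Q + 2 \<le> real p / 2"
    "2 * (real p - 1) * ln (real p) < (real p - 2 - Q) * (2 * log 2 (real p - 1) - 1)"
  obtains m e n where "0 < m" "m < p" "0 < r" "r < p" "0 < e" "e < p" "r * m \<le> p - 1" "n = r * m * e" "2 \<le> n"
    "m * n < p - 1" "n \<le> p - 1" "2 * real (p - 1) * ln (real p) < real n * (real (r * m) - 1)"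
    "real p powr (1 - \<theta>) / (2 * A) \<le> real n" "real n \<le> 2 * real p powr (1 - \<theta>) / A"
proof -
  define m where "m = nat \<lfloor>A * real p powr \<theta>\<rfloor>"
  have m_ge_2: "2 \<le> m"
    using large(1) by (simp add: m_def le_nat_floor)
  have m_le: "real m \<le> A * real p powr \<theta>"
    using large(1) by (simp add: m_def)
  have "A * real p powr \<theta> < real m + 1"
    unfolding m_def by linarith
  \<comment> \<open>Rounding down costs at most a factor 2 because m >= 2.\<close>
  then have m_ge: "A * real p powr \<theta> / 2 \<le> real m"
    using m_ge_2 by linarith
  have log_ge: "1 \<le> log 2 (real p - 1)"
    using p by (simp add: le_log_iff)
  have r_bounds: "2 * log 2 (real p - 1) \<le> real r" "real r < 4 * log 2 (real p - 1)"
    using r p by (simp_all add: log_divisor_def of_nat_diff)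
  have "0 < r"
    using r_bounds log_ge by (intro Nat.gr0I) auto
  define q where "q = r * m ^ 2"
  have "real m ^ 2 \<le> (A * real p powr \<theta>) ^ 2"
    using m_le by (intro power_mono) auto
  also have "\<dots> = A ^ 2 * real p powr (2 * \<theta>)"
    by (simp add: power_mult_distrib power2_eq_square mult_ac flip: powr_add)
  \<comment> \<open>Here \<theta> <= 1/4 enters: it bounds m^2 by a multiple of sqrt p.\<close>
  also have "\<dots> \<le> A ^ 2 * real p powr (1 / 2)"
    using \<theta> p by (intro mult_left_mono powr_mono) auto
  finally have "real m ^ 2 \<le> A ^ 2 * real p powr (1 / 2)" .
  moreover have "real r \<le> 4 * log 2 (real p)"
    using r_bounds p log_mono[of 2 "real p - 1" "real p"] by linarith
  ultimately have "real q \<le> Q"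
    unfolding q_def Q_def of_nat_mult of_nat_power
    using p by (intro mult_mono) auto
  have q_pos: "0 < q"
    using \<open>0 < r\<close> m_ge_2 by (simp add: q_def)
  have q_le: "q \<le> p - 2"
    using \<open>real q \<le> Q\<close> large(2) p by linarith
  define e where "e = (p - 2) div q"
  have e: "q * e \<le> p - 2" "p - 2 < q * e + q"
    using q_pos by (auto simp: e_def) (metis add.commute dividend_less_times_div mult.commute)
  have "0 < e"
    using q_le q_pos by (simp add: e_def div_greater_zero_iff)
  define n where "n = r * m * e"
  have mn: "m * n = q * e"
    by (simp add: n_def q_def power2_eq_square)
  have mn_gt: "real p - 2 - Q < real m * real n"
  proof -
    have "real (p - 2) < real (q * e + q)"
      using e(2) by (simp only: of_nat_less_iff)
    then show ?thesis
      using \<open>real q \<le> Q\<close> p mn[symmetric] by (simp add: of_nat_diff)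
  qed
  have mn_le: "real m * real n \<le> real p - 2"
  proof -
    have "real (m * n) \<le> real (p - 2)"
      using e(1) unfolding mn of_nat_le_iff .
    then show ?thesis
      using p by (simp add: of_nat_diff)
  qed
  have "r * m \<le> q" "m \<le> q" "r \<le> q" "n \<le> m * n" "e \<le> q * e"
    using m_ge_2 \<open>0 < r\<close> q_pos by (auto simp: q_def power2_eq_square)
  then have le: "r * m \<le> p - 2" "m \<le> p - 2" "r \<le> p - 2" "n \<le> p - 2" "e \<le> p - 2"
    using q_le e(1) mn by linarith+
  have "2 * 1 \<le> m * (r * e)"
    using m_ge_2 \<open>0 < r\<close> \<open>0 < e\<close> by (intro mult_le_mono) auto
  then have "2 \<le> n"
    by (simp add: n_def mult_ac)
  have powr: "real p powr (1 - \<theta>) = real p / real p powr \<theta>" "0 < real p powr \<theta>"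
    using p by (simp_all add: powr_diff)
  show ?thesis
  proof (rule that[of m e n])
    show "2 * real (p - 1) * ln (real p) < real n * (real (r * m) - 1)"
    proof -
      have "2 * real (p - 1) * ln (real p) < (real p - 2 - Q) * (2 * log 2 (real p - 1) - 1)"
        using large(3) p by (simp add: of_nat_diff)
      also have "\<dots> \<le> (real m * real n) * (real r - 1)"
        using mn_gt r_bounds log_ge by (intro mult_mono) auto
      \<comment> \<open>From m >= 1 follows m (r - 1) <= r m - 1.\<close>
      also have "\<dots> \<le> real n * (real (r * m) - 1)"
        using m_ge_2 mult_right_mono[of 1 "real m" "real n"] by (simp add: algebra_simps)
      finally show ?thesis .
    qed
    \<comment> \<open>The lower bound for n loses its factor 2 here, through m n > p - 2 - Q >= p/2;
      the upper bound loses its own through m >= A p^\<theta> / 2.\<close>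
    have "real p / 2 \<le> real m * real n"
      using mn_gt large(2) by linarith
    also have "\<dots> \<le> A * real p powr \<theta> * real n"
      using m_le by (intro mult_right_mono) auto
    finally show "real p powr (1 - \<theta>) / (2 * A) \<le> real n"
      unfolding powr(1) using A powr(2) by (simp add: field_simps)
    have "A * real p powr \<theta> / 2 * real n \<le> real m * real n"
      using m_ge by (intro mult_right_mono) auto
    also have "\<dots> \<le> real p"
      using mn_le by linarith
    finally show "real n \<le> 2 * real p powr (1 - \<theta>) / A"
      unfolding powr(1) using A powr(2) by (simp add: field_simps)
    show "m * n < p - 1"
      using e(1) p unfolding mn by linarith
  qed (use le m_ge_2 \<open>0 < r\<close> \<open>0 < e\<close> \<open>2 \<le> n\<close> p n_def in auto)
qed

theorem theorem1p7:
  fixes \<theta> A :: real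
  assumes "0 < \<theta>" and "\<theta> \<le> 1 / 4"
    and "0 < A" and "\<theta> = 1 / 4 \<Longrightarrow> A \<le> 1 / 2"
  shows "infinite {p :: nat. prime p \<and>
    (\<exists>(d :: nat) F.
       real d \<in> {real p powr (1 - \<theta>) / (2 * A) + 1 .. 2 * real p powr (1 - \<theta>) / A + 1} \<and>
       plane_curve (residue_ring (int p)) d F \<and>
       smooth_curve (residue_ring (int p)) F \<and>
       nontrivially_blocking (residue_ring (int p)) F)}"
    (is "infinite ?good")
proof -
  define Q where "Q = (\<lambda>p. 4 * log 2 p * (A ^ 2 * p powr (1 / 2)))"
  obtain N where N: "\<And>p :: nat. N \<le> p \<Longrightarrow> 2 \<le> A * real p powr \<theta> \<and> Q (real p) + 2 \<le> real p / 2 \<and>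
    2 * (real p - 1) * ln (real p) < (real p - 2 - Q (real p)) * (2 * log 2 (real p - 1) - 1)"
    using eventually_parameters_large[OF assms(1,3)] unfolding Q_def eventually_at_top_linorder by blast
  \<comment> \<open>Every large prime with a \<open>log_divisor\<close> is good; the summand 3
    secures p > 2.\<close>
  have "p \<in> ?good" if p: "prime p" and r: "log_divisor p r" and large: "N + 3 \<le> p" for p r
  proof -
    have "2 < p"
      using large by simp
    have N: "2 \<le> A * real p powr \<theta>" "Q (real p) + 2 \<le> real p / 2"
      "2 * (real p - 1) * ln (real p) < (real p - 2 - Q (real p)) * (2 * log 2 (real p - 1) - 1)"
      using N[of p] large by auto
    obtain m e n where params: "0 < m" "m < p" "0 < r" "r < p" "0 < e" "e < p" "r * m \<le> p - 1"
        "n = r * m * e" "2 \<le> n" "m * n < p - 1" "n \<le> p - 1"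
      and hitting: "2 * real (p - 1) * ln (real p) < real n * (real (r * m) - 1)"
      and degree: "real p powr (1 - \<theta>) / (2 * A) \<le> real n" "real n \<le> 2 * real p powr (1 - \<theta>) / A"
      by (rule degree_parameters[OF assms(1-3) \<open>2 < p\<close> r N[unfolded Q_def]]) blast
    have "r dvd p - 1"
      using r by (simp add: log_divisor_def)
    then obtain T Z :: "int set" where T: "finite T" "card T = m" "\<forall>t\<in>T. \<not> int p dvd t"
      and Z: "Z \<subseteq> {1..<int p}" "card Z = r * m" "\<forall>x\<in>Z. \<exists>t\<in>T. [x ^ r = t] (mod int p)"
      using power_fibres[OF p _ params(7)] by metis
    have "Z \<noteq> {}"
      using Z(2) params(1,3) by auto
    then obtain Y where Y: "Y \<subseteq> {1..<int p}" "card Y = n"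
      "\<And>a b. \<lbrakk>a \<in> {1..<int p}; b \<in> {0..<int p}\<rbrakk> \<Longrightarrow> \<exists>x\<in>Z. (a * x + b) mod int p \<in> Y"
      using exists_line_hitting_set[OF p Z(1) _ params(11)] hitting Z(2) by metis
    have "\<exists>F. plane_curve (residue_ring (int p)) (n + 1) F \<and>
      smooth_curve (residue_ring (int p)) F \<and> nontrivially_blocking (residue_ring (int p)) F"
    proof (rule curve_from_hitting_set[OF p T params(1,2) _ _ params(8-10) Y(1,2)])
      show "\<not> p dvd r" "\<not> p dvd e"
        using params(3-6) by (auto dest: dvd_imp_le)
      show "\<exists>x. (\<exists>t\<in>T. [x ^ r = t] (mod int p)) \<and> (a * x + b) mod int p \<in> Y"
        if "a \<in> {1..<int p}" "b \<in> {0..<int p}" for a b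
        using Y(3)[OF that] Z(3) by blast
    qed
    moreover have "real (n + 1) \<in> {real p powr (1 - \<theta>) / (2 * A) + 1 .. 2 * real p powr (1 - \<theta>) / A + 1}"
      using degree by simp
    ultimately show ?thesis
      using p by blast
  qed
  then have "{p. prime p \<and> (\<exists>r. log_divisor p r)} - {..<N + 3} \<subseteq> ?good"
    by auto
  moreover have "infinite ({p. prime p \<and> (\<exists>r. log_divisor p r)} - {..<N + 3})"
    using infinite_primes_log_divisor by (rule Diff_infinite_finite[rotated]) simp
  ultimately show ?thesis
    by (rule infinite_super)
qed

end
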